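(* Let $(\mathbb{X},d)$ be a metric measure space with a polar decomposition at a point $a\in\mathbb{X}$, let $s>0$ and $1<p<q<\infty$, with $p'=\frac p{p-1}$, $q'=\frac q{q-1}$. Let $v$ and $z$ be non-negative measurable functions on $\mathbb{X}$, and define $$V(x)=\int_{B(a,|x|_a)}v(y)\,dy,\qquad A(x):=\frac{1}{|B(a,|x|_a)|^{\frac qp}}\left(\int_{B(a,|x|_a)}\left(\frac{v^p(y)}{z(y)}\right)^{\frac1{p-1}}dy\right)^{-\frac q{p'}}V^q(x)\,v(x),$$ $$D_1:=\sup_{x\neq a}\left[\left(\int_{\mathbb{X}\setminus B(a,|x|_a)}\frac{A(y)}{|y|_a^{sq}V^q(y)}\,dy\right)^{\frac1q}\left(\int_{B(a,|x|_a)}\left(\frac{A(y)v^{-q}(y)}{|y|_a^{sq}}\right)^{1-q'}dy\right)^{\frac1{q'}}\right],$$ and assume $D_1<\infty$ and $(q')^{\frac1{q'}}q^{\frac1q}D_1<1$. Then there is a constant $C>0$ such that for every measurable $u$ on $\mathbb{X}$ for which $G:=A^{\frac1q}|u|\,|\cdot|_a^{-s}$ belongs to $L^p(\mathbb{X})\cap L^q(\mathbb{X})$ and is not a.e. zero, $$\int_{\mathbb{X}}\frac{G^p}{\|G\|^p_{L^p(\mathbb{X})}}\log\left(\frac{G^p}{\|G\|^p_{L^p(\mathbb{X})}}\right)dx\le\frac{q}{q-p}\log\left(C\,\frac{\left(\int_{\mathbb{X}}\left(\int_{\mathbb{X}}\frac{|u(x)-u(y)|^pz(x)}{d^{sp}(x,y)\left|B\left(a,\frac{d(x,y)}2\right)\right|}dx\right)^{\frac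 qp}v(y)\,dy\right)^{\frac pq}}{\|G\|^p_{L^p(\mathbb{X})}}\right).$$
   Context: $(\mathbb{X},d)$ is a metric space equipped with a Borel measure $dx$; $|E|$ denotes the measure of a set $E$. $B(a,r)=\{x\in\mathbb{X}: d(x,a)<r\}$ and $|x|_a:=d(a,x)$. "Polar decomposition at $a$" means: there is a locally integrable function $\lambda$ such that, with $\Sigma_r=\{x\in\mathbb{X}: d(x,a)=r\}$ equipped with a measure $d\omega_r$, for every $f\in L^1(\mathbb{X})$ one has $\int_{\mathbb{X}}f(x)\,dx=\int_0^\infty\int_{\Sigma_r}f(r,\omega)\lambda(r,\omega)\,d\omega_r\,dr$. The constant $C$ is independent of $u$. *)

theory Defs
  imports "HOL-Analysis.Analysis"
begin

definition epow :: "ennreal \<Rightarrow> real \<Rightarrow> ennreal" where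
  "epow x e = (if e = 0 then 1
     else if x = 0 then (if e < 0 then \<infinity> else 0)
     else if x = \<infinity> then (if e < 0 then 0 else \<infinity>)
     else ennreal (enn2real x powr e))"

definition polar_decomposition :: "'a::metric_space measure \<Rightarrow> 'a \<Rightarrow> bool" where
  "polar_decomposition M a \<longleftrightarrow>
     (\<exists>(lam :: real \<Rightarrow> 'a \<Rightarrow> real) (om :: real \<Rightarrow> 'a measure).
        (\<forall>r. space (om r) = sphere a r) \<and>
        (\<forall>f :: 'a \<Rightarrow> real. integrable M f \<longrightarrow>
           integral\<^sup>L M f = (LINT r:{0<..}|lborel. integral\<^sup>L (om r) (\<lambda>w. f w * lam r w))))"

definition Vfun :: "'a::metric_space measure \<Rightarrow> 'a \<Rightarrow> ('a \<Rightarrow> real) \<Rightarrow> 'a \<Rightarrow> ennreal" where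
  "Vfun M a v x = (\<integral>\<^sup>+ y \<in> ball a (dist a x). ennreal (v y) \<partial>M)"

definition Afun :: "'a::metric_space measure \<Rightarrow> 'a \<Rightarrow> real \<Rightarrow> real \<Rightarrow> ('a \<Rightarrow> real) \<Rightarrow> ('a \<Rightarrow> real) \<Rightarrow> 'a \<Rightarrow> ennreal" where
  "Afun M a p q v z x =
     epow (emeasure M (ball a (dist a x))) (- (q / p))
     * epow (\<integral>\<^sup>+ y \<in> ball a (dist a x).
               epow (epow (ennreal (v y)) p / ennreal (z y)) (1 / (p - 1)) \<partial>M)
            (- (q / (p / (p - 1))))
     * epow (Vfun M a v x) q * ennreal (v x)"

definition D1 :: "'a::metric_space measure \<Rightarrow> 'a \<Rightarrow> real \<Rightarrow> real \<Rightarrow> real \<Rightarrow> ('a \<Rightarrow> real) \<Rightarrow> ('a \<Rightarrow> real) \<Rightarrow> ennreal" where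
  "D1 M a s p q v z =
     (SUP x \<in> UNIV - {a}.
        epow (\<integral>\<^sup>+ y \<in> UNIV - ball a (dist a x).
                Afun M a p q v z y / (epow (ennreal (dist a y)) (s * q) * epow (Vfun M a v y) q) \<partial>M)
             (1 / q)
      * epow (\<integral>\<^sup>+ y \<in> ball a (dist a x).
                epow (Afun M a p q v z y * epow (ennreal (v y)) (- q)
                        / epow (ennreal (dist a y)) (s * q)) (1 - q / (q - 1)) \<partial>M)
             (1 / (q / (q - 1))))"

definition Gfun :: "'a::metric_space measure \<Rightarrow> 'a \<Rightarrow> real \<Rightarrow> real \<Rightarrow> real \<Rightarrow> ('a \<Rightarrow> real) \<Rightarrow> ('a \<Rightarrow> real) \<Rightarrow> ('a \<Rightarrow> real) \<Rightarrow> 'a \<Rightarrow> ennreal" where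
  "Gfun M a s p q v z u x =
     epow (Afun M a p q v z x) (1 / q) * ennreal \<bar>u x\<bar> * epow (ennreal (dist a x)) (- s)"

definition entropy_int :: "'a measure \<Rightarrow> ('a \<Rightarrow> real) \<Rightarrow> ereal" where
  "entropy_int M g =
     (let h = (\<lambda>x. if g x = 0 then 0 else g x * ln (g x)) in
      enn2ereal (\<integral>\<^sup>+ x. ennreal (max 0 (h x)) \<partial>M) - enn2ereal (\<integral>\<^sup>+ x. ennreal (max 0 (- h x)) \<partial>M))"

definition Ifun :: "'a::metric_space measure \<Rightarrow> 'a \<Rightarrow> real \<Rightarrow> real \<Rightarrow> real \<Rightarrow> ('a \<Rightarrow> real) \<Rightarrow> ('a \<Rightarrow> real) \<Rightarrow> ('a \<Rightarrow> real) \<Rightarrow> ennreal" where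
  "Ifun M a s p q v z u =
     (\<integral>\<^sup>+ y. epow (\<integral>\<^sup>+ x. ennreal (\<bar>u x - u y\<bar> powr p * z x)
                        / (epow (ennreal (dist x y)) (s * p) * emeasure M (ball a (dist x y / 2))) \<partial>M)
                   (q / p) * ennreal (v y) \<partial>M)"

end

theory Submission
  imports Defs
begin

text \<open>
  By Jensen's inequality for the probability density G^p / ||G||_p^p, the entropy is at most
  q / (q - p) * log (||G||_q^p / ||G||_p^p), so it suffices to bound ||G||_q^q by a multiple of the
  double integral. Compare u(x) with its v-weighted mean over the ball B(a, |x|_a): Hoelder's inequality
  bounds the difference by the double integral (the weight A is chosen so that all other factors
  cancel), and the mean is controlled by the weighted Hardy inequality with constant
  K = (q')^(1/q') q^(1/q) D_1. As K < 1, the mean can be absorbed into the left-hand side.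

  The Hardy inequality is Muckenhoupt's argument: Hoelder's inequality against a power of the
  distribution function of the dual weight, then Tonelli's theorem. Both one-dimensional integrals
  in it are instances of \<open>\<integral> N{\<rho> \<ge> \<rho> x} powr (- b) dN(x) \<le> N(space) powr (1 - b) / (1 - b)\<close>, which is a
  layer-cake estimate valid for every measure, so atoms and spheres of positive measure are harmless.
\<close>

subsection \<open>Powers of extended non-negative reals\<close>

text \<open>Absorption is possible because Hardy's inequality compares one function with itself: the
  weights are tied to \<open>G\<close> so that \<open>om * (|u| v)^q\<close> equals
  \<open>G^q\<close>, and so does \<open>w * (|u| V)^q\<close> wherever \<open>A\<close> is neither
  0 nor infinite. The integral of \<open>G^q\<close> must be finite before it can be subtracted.
  Three obstacles shape the details. The measure comes without sigma-finiteness, so measurability of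
  integrals over balls is obtained from monotonicity in the radius. Spheres may carry mass, so the
  open balls and closed exteriors in \<open>D1\<close> have to be told apart from the closed balls
  and open exteriors that arise after exchanging integrals. And \<open>0 * \<infinity> = 0\<close>
  in \<open>ennreal\<close>, so weights cancel only at points where they are positive and finite;
  all other points are treated separately. The constant is \<open>C = c powr (p / q)\<close> with
  \<open>c = (1 - \<kappa>) powr (- q) * 2 powr (s * q)\<close>: the 2 comes from d(x,y) < 2 |x|_a
  when |y|_a < |x|_a, the other factor from absorption.\<close>

lemma epow_zero [simp]: "epow 0 e = (if e = 0 then 1 else if e < 0 then \<infinity> else 0)"
  and epow_top [simp]: "epow top e = (if e = 0 then 1 else if e < 0 then 0 else top)"
  and epow_exp_zero [simp]: "epow x 0 = 1"
  by (auto simp: epow_def)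

lemma epow_one [simp]: "epow 1 e = 1"
  by (simp add: epow_def)

lemma epow_ennreal: "r > 0 \<Longrightarrow> epow (ennreal r) e = ennreal (r powr e)"
  by (auto simp: epow_def)

lemma epow_ennreal_nonneg: "r \<ge> 0 \<Longrightarrow> e > 0 \<Longrightarrow> epow (ennreal r) e = ennreal (r powr e)"
  by (cases "r = 0") (auto simp: epow_ennreal)

lemma ennreal_zero_pos_top_cases [case_names zero pos top]:
  fixes x :: ennreal
  obtains "x = 0" | r where "r > 0" "x = ennreal r" | "x = \<infinity>"
  by (cases x) (auto simp: less_le)

lemma epow_one_exp [simp]: "epow x 1 = x"
  by (cases x rule: ennreal_zero_pos_top_cases) (auto simp: epow_ennreal)

text \<open>No side condition is necessary: negative exponents swap 0 and \<infinity>, and exponent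
  0 yields 1 everywhere, so the degenerate values compose consistently.\<close>

lemma epow_epow: "epow (epow x a) b = epow x (a * b)"
proof (cases x rule: ennreal_zero_pos_top_cases)
  case (pos r)
  then show ?thesis by (simp add: epow_ennreal powr_powr)
qed (auto simp: mult_less_0_iff zero_less_mult_iff)

lemma epow_minus: "epow x (- e) = inverse (epow x e)"
proof (cases x rule: ennreal_zero_pos_top_cases)
  case (pos r)
  then show ?thesis by (simp add: epow_ennreal powr_minus inverse_ennreal)
qed auto

text \<open>Fails for negative \<open>e\<close>: with \<open>x = 0\<close> and
  \<open>y = \<infinity>\<close> the left side is \<infinity> and the right side is
  \<open>\<infinity> * 0 = 0\<close>.\<close>

lemma epow_mult:
  assumes "e \<ge> 0"
  shows "epow (x * y) e = epow x e * epow y e"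
proof (cases "e = 0")
  case False
  with assms have e: "e > 0" by simp
  show ?thesis
  proof (cases x rule: ennreal_zero_pos_top_cases)
    case zero
    then show ?thesis using e by simp
  next
    case top
    then show ?thesis using e
      by (cases y rule: ennreal_zero_pos_top_cases)
         (auto simp: ennreal_top_mult epow_ennreal)
  next
    case (pos r)
    then show ?thesis using e
      by (cases y rule: ennreal_zero_pos_top_cases)
         (auto simp: ennreal_mult_top epow_ennreal powr_mult simp flip: ennreal_mult')
  qed
qed simp

lemma epow_mono:
  assumes "e \<ge> 0" "x \<le> y"
  shows "epow x e \<le> epow y e"
proof (cases "e = 0")
  case False
  with assms have e: "e > 0" by simp
  show ?thesis
  proof (cases "y = \<infinity>")
    case False
    then obtain r t where "r \<ge> 0" "t \<ge> 0" "x = ennreal r" "y = ennreal t"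
      using assms(2) by (cases x; cases y) (auto simp: top_unique)
    then show ?thesis using e assms(2)
      by (auto simp: epow_ennreal_nonneg intro!: powr_mono2)
  qed (use e in auto)
qed simp

lemma inverse_antimono_ennreal: "x \<le> y \<Longrightarrow> inverse y \<le> inverse (x :: ennreal)"
  by (cases x rule: ennreal_zero_pos_top_cases; cases y rule: ennreal_zero_pos_top_cases)
     (auto simp: inverse_ennreal top_unique le_imp_inverse_le)

lemma epow_eq_0_iff: "epow x e = 0 \<longleftrightarrow> (e > 0 \<and> x = 0 \<or> e < 0 \<and> x = top)"
  by (cases x rule: ennreal_zero_pos_top_cases) (auto simp: epow_ennreal)

lemma epow_eq_top_iff: "epow x e = top \<longleftrightarrow> (e > 0 \<and> x = top \<or> e < 0 \<and> x = 0)"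
  by (cases x rule: ennreal_zero_pos_top_cases) (auto simp: epow_ennreal)

text \<open>At 0 and \<infinity> exponents of opposite sign would give
  \<open>0 * \<infinity> = 0\<close>, whereas \<open>a + b = 0\<close> requires 1. Every later
  cancellation of weights therefore needs finite non-zero values.\<close>

lemma epow_add:
  assumes "x \<noteq> 0" "x \<noteq> \<infinity>"
  shows "epow x (a + b) = epow x a * epow x b"
  using assms
  by (cases x rule: ennreal_zero_pos_top_cases) (auto simp: epow_ennreal powr_add ennreal_mult')

lemma epow_measurable [measurable (raw)]:
  assumes [measurable]: "f \<in> borel_measurable M"
  shows "(\<lambda>x. epow (f x) e) \<in> borel_measurable M"
  unfolding epow_def by measurable

section \<open>Young's and Hoelder's inequalities for extended non-negative functions\<close>

lemma young_ennreal:
  fixes x y :: ennreal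
  assumes "1 < p"
  shows "x * y \<le> ennreal (1 / p) * epow x p + ennreal (1 - 1 / p) * epow y (p / (p - 1))"
proof -
  have pos: "p > 0" "p / (p - 1) > 0" "1 - 1/p > 0" using assms by auto
  consider "x = 0 \<or> y = 0" | "x = \<infinity> \<or> y = \<infinity>" | r t where "r > 0" "t > 0" "x = ennreal r" "y = ennreal t"
    by (cases x rule: ennreal_zero_pos_top_cases; cases y rule: ennreal_zero_pos_top_cases) auto
  then show ?thesis
  proof cases
    case 2
    then show ?thesis using pos assms by (auto simp: ennreal_mult_top divide_less_0_iff)
  next
    case (3 r t)
    have "r * t \<le> (1 / p) * r powr p + (1 - 1 / p) * t powr (p / (p - 1))"
      using Youngs_inequality_0[of "1/p" "1 - 1/p" "r powr p" "t powr (p/(p-1))"] 3 assms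
      by (simp add: powr_powr) (simp add: field_simps)
    then show ?thesis using 3 pos
      by (simp add: epow_ennreal flip: ennreal_mult ennreal_plus del: ennreal_mult' ennreal_mult'')
  qed auto
qed

lemma hoelder_nn_integral:
  fixes f g :: "'a \<Rightarrow> ennreal"
  assumes [measurable]: "f \<in> borel_measurable M" "g \<in> borel_measurable M" and p: "1 < p"
  shows "(\<integral>\<^sup>+x. f x * g x \<partial>M) \<le>
    epow (\<integral>\<^sup>+x. epow (f x) p \<partial>M) (1 / p) * epow (\<integral>\<^sup>+x. epow (g x) (p / (p - 1)) \<partial>M) (1 - 1 / p)"
    (is "_ \<le> epow ?F _ * epow ?G _")
proof -
  define p' where "p' = p / (p - 1)"
  have pos: "p > 0" "p' > 0" "1 - 1/p > 0" and inv: "p' * (1 - 1/p) = 1" "(1 - 1/p) * p' = 1"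
    using p by (auto simp: p'_def field_simps)
  \<comment> \<open>If one norm is 0 and the other infinite, the right side is 0 by convention, so
    the vanishing cases must be settled before the infinite ones.\<close>
  have zF: "(\<integral>\<^sup>+x. f x * g x \<partial>M) = 0" if "?F = 0"
    using that pos by (auto simp: nn_integral_0_iff_AE epow_eq_0_iff elim: eventually_mono)
  have zG: "(\<integral>\<^sup>+x. f x * g x \<partial>M) = 0" if "?G = 0"
    using that pos by (auto simp: nn_integral_0_iff_AE epow_eq_0_iff p'_def[symmetric] elim: eventually_mono)
  consider "?F = 0 \<or> ?G = 0" | "?F \<noteq> 0" "?G \<noteq> 0" "?F = \<infinity> \<or> ?G = \<infinity>"
    | "?F \<noteq> 0" "?G \<noteq> 0" "?F \<noteq> \<infinity>" "?G \<noteq> \<infinity>" by blast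
  then show ?thesis
  proof cases
    case 1
    then show ?thesis using zF zG by auto
  next
    case 2
    then have "epow ?F (1 / p) * epow ?G (1 - 1 / p) = \<infinity>"
      using pos epow_eq_0_iff[of ?F "1/p"] epow_eq_0_iff[of ?G "1 - 1/p"]
      by (auto simp: ennreal_mult_eq_top_iff)
    then show ?thesis by simp
  next
    case 3
    obtain \<alpha> \<beta> where \<alpha>: "\<alpha> > 0" "?F = ennreal \<alpha>" and \<beta>: "\<beta> > 0" "?G = ennreal \<beta>"
      using 3 by (metis ennreal_zero_pos_top_cases)
    \<comment> \<open>\<open>a\<close> and \<open>b\<close> are the two norms; Young's inequality is
      applied to \<open>f / a\<close> and \<open>g / b\<close>, whose norms are 1.\<close>
    define a where "a = \<alpha> powr (1/p)"
    define b where "b = \<beta> powr (1 - 1/p)"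
    have ab: "a > 0" "b > 0" using \<alpha> \<beta> by (auto simp: a_def b_def)
    have *: "epow (ennreal (1/a)) p * ennreal \<alpha> = 1" "epow (ennreal (1/b)) p' * ennreal \<beta> = 1"
      using \<alpha>(1) \<beta>(1) pos inv
      by (auto simp: a_def b_def epow_ennreal powr_divide powr_powr simp flip: ennreal_mult' ennreal_1)
    have "(\<integral>\<^sup>+x. (ennreal (1/a) * f x) * (ennreal (1/b) * g x) \<partial>M) \<le>
      (\<integral>\<^sup>+x. ennreal (1 / p) * epow (ennreal (1/a) * f x) p + ennreal (1 - 1 / p) * epow (ennreal (1/b) * g x) p' \<partial>M)"
      unfolding p'_def by (intro nn_integral_mono young_ennreal p)
    also have "\<dots> = ennreal (1 / p) * (epow (ennreal (1/a)) p * ?F) + ennreal (1 - 1 / p) * (epow (ennreal (1/b)) p' * ?G)"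
      using pos by (simp add: epow_mult nn_integral_add nn_integral_cmult p'_def[symmetric])
    also have "\<dots> = ennreal (1/p + (1 - 1/p))"
      using pos unfolding \<alpha> \<beta> * by (subst ennreal_plus) auto
    finally have le: "(\<integral>\<^sup>+x. (ennreal (1/a) * f x) * (ennreal (1/b) * g x) \<partial>M) \<le> 1" by simp
    have "(\<integral>\<^sup>+x. (ennreal (1/a) * f x) * (ennreal (1/b) * g x) \<partial>M) = ennreal (1/(a*b)) * (\<integral>\<^sup>+x. f x * g x \<partial>M)"
      using ab by (subst nn_integral_cmult[symmetric]) (auto simp: ennreal_mult'' mult_ac intro!: nn_integral_cong simp flip: ennreal_mult)
    then have "ennreal (a * b) * (ennreal (1/(a*b)) * (\<integral>\<^sup>+x. f x * g x \<partial>M)) \<le> ennreal (a*b) * 1"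
      using le by (metis mult_left_mono zero_le)
    moreover have "ennreal (a * b) * ennreal (1/(a*b)) = 1"
      using ab by (simp flip: ennreal_mult ennreal_1)
    ultimately have "(\<integral>\<^sup>+x. f x * g x \<partial>M) \<le> ennreal (a*b)"
      by (simp add: mult.assoc[symmetric])
    also have "\<dots> = epow ?F (1/p) * epow ?G (1 - 1/p)"
      using \<alpha> \<beta> by (simp add: a_def b_def epow_ennreal ennreal_mult)
    finally show ?thesis .
  qed
qed

subsection \<open>Integrals of powers of tails\<close>

text \<open>Replaces an uncountable union of tails by a countable increasing one. A minimum of
  \<open>\<rho>\<close> on \<open>E\<close>, if attained, gives a constant sequence; otherwise the
  values of \<open>\<rho>\<close> along the sequence decrease to the infimum and pass below each
  value on \<open>E\<close>.\<close>

lemma exists_cofinal_sequence: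
  fixes \<rho> :: "'a \<Rightarrow> real"
  assumes "E \<noteq> {}"
  obtains xs :: "nat \<Rightarrow> 'a" where "range xs \<subseteq> E" "decseq (\<lambda>n. \<rho> (xs n))"
    "E \<subseteq> (\<Union>n. {y. \<rho> (xs n) \<le> \<rho> y})"
proof (cases "\<exists>x0\<in>E. \<forall>x\<in>E. \<rho> x0 \<le> \<rho> x")
  case True
  then obtain x0 where "x0 \<in> E" "\<forall>x\<in>E. \<rho> x0 \<le> \<rho> x" by blast
  then show ?thesis by (intro that[of "\<lambda>_. x0"]) (auto simp: decseq_def)
next
  case False
  \<comment> \<open>The infimum is formed in \<open>ereal\<close> because \<open>\<rho>\<close> may
    be unbounded below on \<open>E\<close>.\<close>
  obtain f where f: "decseq f" "range f \<subseteq> (\<lambda>x. ereal (\<rho> x)) ` E"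
    "Inf ((\<lambda>x. ereal (\<rho> x)) ` E) = (INF i. f i)"
    using Inf_countable_INF[of "(\<lambda>x. ereal (\<rho> x)) ` E"] assms by auto
  have "\<forall>n. \<exists>x\<in>E. f n = ereal (\<rho> x)" using f(2) by blast
  then obtain xs where xs: "\<And>n. xs n \<in> E" "\<And>n. f n = ereal (\<rho> (xs n))" by metis
  show ?thesis
  proof (rule that[of xs])
    show "range xs \<subseteq> E" using xs by auto
    show "decseq (\<lambda>n. \<rho> (xs n))" using f(1) xs by (auto simp: decseq_def)
    show "E \<subseteq> (\<Union>n. {y. \<rho> (xs n) \<le> \<rho> y})"
    proof
      fix y assume "y \<in> E"
      then obtain x where "x \<in> E" "\<rho> x < \<rho> y" using False by (auto simp: not_le)
      then have "(INF i. f i) < ereal (\<rho> y)"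
        unfolding f(3)[symmetric] by (auto simp: Inf_less_iff)
      then obtain n where "f n < ereal (\<rho> y)" by (auto simp: INF_less_iff)
      then show "y \<in> (\<Union>n. {y. \<rho> (xs n) \<le> \<rho> y})" using xs by (auto intro!: exI[of _ n])
    qed
  qed
qed

text \<open>Continuity from below along an increasing sequence of tails that covers
  \<open>E\<close>. This takes the place of continuity of the distribution function, which atoms
  destroy.\<close>

lemma emeasure_le_of_tails:
  fixes \<rho> :: "'a \<Rightarrow> real"
  assumes [measurable]: "\<rho> \<in> borel_measurable N"
    and tails: "\<And>x. x \<in> E \<Longrightarrow> emeasure N {y \<in> space N. \<rho> x \<le> \<rho> y} \<le> c"
    and E: "E \<subseteq> space N"
  shows "emeasure N E \<le> c"
proof (cases "E = {}")
  case False
  then obtain xs where xs: "range xs \<subseteq> E" "decseq (\<lambda>n. \<rho> (xs n))"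
    "E \<subseteq> (\<Union>n. {y. \<rho> (xs n) \<le> \<rho> y})" by (rule exists_cofinal_sequence)
  have "emeasure N E \<le> emeasure N (\<Union>n. {y \<in> space N. \<rho> (xs n) \<le> \<rho> y})"
    using xs(3) E by (intro emeasure_mono) auto
  also have "\<dots> = (SUP n. emeasure N {y \<in> space N. \<rho> (xs n) \<le> \<rho> y})"
    using xs(2) by (intro SUP_emeasure_incseq[symmetric]) (auto simp: incseq_def decseq_def intro: order_trans)
  also have "\<dots> \<le> c" using xs(1) by (intro SUP_least tails) auto
  finally show ?thesis .
qed simp

section \<open>Measurability of monotone functions of the radius\<close>

lemma borel_measurable_mono_ennreal:
  fixes f :: "real \<Rightarrow> ennreal"
  assumes "mono f"
  shows "f \<in> borel_measurable borel"
proof (rule borel_measurableI_greater)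
  fix y :: ennreal
  have "is_interval {x. y < f x}"
    using assms by (auto simp: is_interval_1 mono_def intro: less_le_trans)
  then show "{x \<in> space borel. y < f x} \<in> sets borel"
    by (simp add: real_interval_borel_measurable)
qed

text \<open>Integrals over balls and their complements depend on the centre only through the radius,
  and monotonically, so their measurability needs no product measure. For decreasing functions the
  lemma is used with \<open>- \<rho>\<close>.\<close>

lemma borel_measurable_mono_comp:
  fixes F :: "'a \<Rightarrow> ennreal" and \<rho> :: "'a \<Rightarrow> real"
  assumes "\<rho> \<in> borel_measurable M" "\<And>r t. r \<le> t \<Longrightarrow> f r \<le> f t" "\<And>x. F x = f (\<rho> x)"
  shows "F \<in> borel_measurable M"
proof -
  have "F = (\<lambda>x. f (\<rho> x))" using assms(3) by blast
  then show ?thesis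
    using measurable_compose[OF assms(1) borel_measurable_mono_ennreal[of f]] assms(2)
    by (simp add: mono_def)
qed

section \<open>The layer-cake estimate\<close>

lemma nn_integral_powr_0_to:
  assumes "0 < m" "b < 1"
  shows "(\<integral>\<^sup>+t. ennreal (t powr (- b)) * indicator {0<..m} t \<partial>lborel) = ennreal (m powr (1 - b) / (1 - b))"
proof -
  have "((\<lambda>x. x powr (- b)) has_integral (m powr (1 - b) / (1 - b))) {0..m}"
    using has_integral_powr_from_0[of "- b" m] assms by simp
  then have "(\<integral>\<^sup>+t. ennreal (t powr (- b)) * indicator {0..m} t \<partial>lborel) = ennreal (m powr (1 - b) / (1 - b))"
    by (intro nn_integral_has_integral_lebesgue') auto
  then show ?thesis
    by (subst (asm) nn_integral_cong_AE[where v = "\<lambda>t. ennreal (t powr (- b)) * indicator {0<..m} t"])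
       (auto intro!: AE_I[where N = "{0}"] split: split_indicator)
qed

text \<open>The cut-off \<open>m\<close> will be the total mass, which bounds every tail; levels
  above it are collected in the constant \<open>m powr (- b)\<close>.\<close>

lemma powr_minus_layer_cake:
  assumes "0 < t" "t \<le> m" "0 < b"
  shows "ennreal (t powr (- b)) = ennreal (m powr (- b)) +
    (\<integral>\<^sup>+r. ennreal (b * r powr (- b - 1)) * indicator {t..m} r \<partial>lborel)"
proof -
  have "(\<integral>\<^sup>+r. ennreal (b * r powr (- b - 1)) * indicator {t..m} r \<partial>lborel)
      = ennreal (- (m powr (- b)) - (- (t powr (- b))))"
    using assms
    by (intro nn_integral_FTC_Icc) (auto intro!: derivative_eq_intros simp: powr_mult_base mult_ac)
  moreover have "m powr (- b) \<le> t powr (- b)" using assms by (intro powr_mono2') auto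
  ultimately show ?thesis by (simp flip: ennreal_plus)
qed

text \<open>The tail mass \<open>T\<close> satisfies \<open>N {T \<le> r} \<le> r\<close>, as if it
  were uniformly distributed, with equality lost only through atoms. The layer cake then gives at
  most m^(1-b) + b * (integral of r^(-b) over (0,m]) = m^(1-b) / (1-b); \<open>b < 1\<close> is
  needed for convergence at 0.\<close>

lemma nn_integral_tail_powr_le:
  fixes \<rho> :: "'a \<Rightarrow> real"
  assumes [measurable]: "\<rho> \<in> borel_measurable N" and b: "0 < b" "b < 1"
  shows "(\<integral>\<^sup>+x. epow (emeasure N {y \<in> space N. \<rho> x \<le> \<rho> y}) (- b) \<partial>N)
    \<le> ennreal (1 / (1 - b)) * epow (emeasure N (space N)) (1 - b)"
proof (cases "emeasure N (space N)" rule: ennreal_zero_pos_top_cases)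
  case zero
  then have "(\<integral>\<^sup>+x. epow (emeasure N {y \<in> space N. \<rho> x \<le> \<rho> y}) (- b) \<partial>N) = (\<integral>\<^sup>+x. 0 \<partial>N)"
    by (intro nn_integral_cong_AE AE_I[where N = "space N"]) auto
  then show ?thesis by simp
next
  case top
  then show ?thesis using b by (simp add: ennreal_mult_top)
next
  case (pos m)
  interpret N: finite_measure N by (rule finite_measureI) (simp add: pos)
  interpret P: pair_sigma_finite N lborel by unfold_locales
  define T where "T = (\<lambda>x. emeasure N {y \<in> space N. \<rho> x \<le> \<rho> y})"
  have [measurable]: "T \<in> borel_measurable N"
  proof (rule borel_measurable_mono_comp[where \<rho> = "\<lambda>x. - \<rho> x" and f = "\<lambda>r. emeasure N {y \<in> space N. - r \<le> \<rho> y}"])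
    show "emeasure N {y \<in> space N. - r \<le> \<rho> y} \<le> emeasure N {y \<in> space N. - t \<le> \<rho> y}" if "r \<le> t" for r t
      using that by (intro emeasure_mono) auto
  qed (auto simp: T_def)
  \<comment> \<open>Every point of \<open>{T \<le> c}\<close> has a tail of mass at most
    \<open>c\<close>, and these tails cover the set.\<close>
  have T_le: "emeasure N {x \<in> space N. T x \<le> c} \<le> c" for c
    by (rule emeasure_le_of_tails[where \<rho> = \<rho>]) (auto simp: T_def)
  have T_le_m: "T x \<le> ennreal m" for x
    unfolding T_def pos(2)[symmetric] by (intro emeasure_mono) auto
  have T_pos: "AE x in N. T x \<noteq> 0"
    using T_le[of 0] by (intro AE_I[where N = "{x \<in> space N. T x \<le> 0}"]) auto
  define k where "k = (\<lambda>r. ennreal (b * r powr (- b - 1)) * indicator {0<..m} r)"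
  have [measurable]: "k \<in> borel_measurable borel" unfolding k_def by measurable
  have "(\<integral>\<^sup>+x. epow (T x) (- b) \<partial>N)
      \<le> (\<integral>\<^sup>+x. ennreal (m powr (- b)) + (\<integral>\<^sup>+r. k r * indicator {x. T x \<le> ennreal r} x \<partial>lborel) \<partial>N)"
    using T_pos
  proof (intro nn_integral_mono_AE, eventually_elim)
    fix x assume "T x \<noteq> 0"
    then obtain t where t: "t > 0" "T x = ennreal t"
      using T_le_m[of x] by (cases "T x" rule: ennreal_zero_pos_top_cases) (auto simp: top_unique)
    then have tm: "t \<le> m" using T_le_m[of x] pos by auto
    have "(\<integral>\<^sup>+r. ennreal (b * r powr (- b - 1)) * indicator {t..m} r \<partial>lborel)
        = (\<integral>\<^sup>+r. k r * indicator {x. T x \<le> ennreal r} x \<partial>lborel)"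
      using t tm b by (intro nn_integral_cong) (auto simp: k_def split: split_indicator)
    then show "epow (T x) (- b) \<le> ennreal (m powr (- b)) + (\<integral>\<^sup>+r. k r * indicator {x. T x \<le> ennreal r} x \<partial>lborel)"
      using powr_minus_layer_cake[OF t(1) tm b(1)] t by (simp add: epow_ennreal)
  qed
  also have "\<dots> = ennreal (m powr (- b)) * ennreal m + (\<integral>\<^sup>+x. (\<integral>\<^sup>+r. k r * indicator {x. T x \<le> ennreal r} x \<partial>lborel) \<partial>N)"
    by (subst nn_integral_add) (auto simp: pos)
  also have "(\<integral>\<^sup>+x. (\<integral>\<^sup>+r. k r * indicator {x. T x \<le> ennreal r} x \<partial>lborel) \<partial>N)
      = (\<integral>\<^sup>+r. (\<integral>\<^sup>+x. k r * indicator {x. T x \<le> ennreal r} x \<partial>N) \<partial>lborel)"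
    by (rule P.Fubini'[symmetric]) simp
  also have "\<dots> = (\<integral>\<^sup>+r. k r * emeasure N {x \<in> space N. T x \<le> ennreal r} \<partial>lborel)"
    by (intro nn_integral_cong) (simp add: nn_integral_cmult nn_integral_indicator' Int_def conj_commute)
  also have "\<dots> \<le> (\<integral>\<^sup>+r. ennreal b * (ennreal (r powr (- b)) * indicator {0<..m} r) \<partial>lborel)"
  proof (rule nn_integral_mono)
    fix r
    have "k r * emeasure N {x \<in> space N. T x \<le> ennreal r} \<le> k r * ennreal r"
      by (intro mult_left_mono T_le) auto
    also have "\<dots> = ennreal b * (ennreal (r powr (- b)) * indicator {0<..m} r)"
    proof (cases "r \<in> {0<..m}")
      case True
      then have "r powr (- b - 1) * r = r powr (- b)" by (simp add: powr_diff)
      then have "b * r powr (- b - 1) * r = b * r powr (- b)" by (simp add: mult.assoc)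
      then show ?thesis using True b unfolding k_def by (simp flip: ennreal_mult)
    qed (simp add: k_def)
    finally show "k r * emeasure N {x \<in> space N. T x \<le> ennreal r}
      \<le> ennreal b * (ennreal (r powr (- b)) * indicator {0<..m} r)" .
  qed
  also have "\<dots> = ennreal b * ennreal (m powr (1 - b) / (1 - b))"
    by (subst nn_integral_cmult) (use pos b in \<open>auto simp: nn_integral_powr_0_to\<close>)
  also have "ennreal (m powr (- b)) * ennreal m + ennreal b * ennreal (m powr (1 - b) / (1 - b))
      = ennreal (m powr (- b) * m + b * (m powr (1 - b) / (1 - b)))"
  proof -
    have "ennreal b * ennreal (m powr (1 - b) / (1 - b)) = ennreal (b * (m powr (1 - b) / (1 - b)))"
      using b by (intro ennreal_mult[symmetric]) auto
    moreover have "ennreal (m powr (- b)) * ennreal m = ennreal (m powr (- b) * m)"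
      using pos by (intro ennreal_mult[symmetric]) auto
    ultimately show ?thesis using b pos by (subst ennreal_plus) auto
  qed
  also have "m powr (- b) * m + b * (m powr (1 - b) / (1 - b)) = 1 / (1 - b) * m powr (1 - b)"
  proof -
    have "m powr (- b) * m = m powr (1 - b)" using pos(1) by (simp add: powr_diff powr_minus field_simps)
    then show ?thesis using b by (simp add: field_simps)
  qed
  also have "ennreal \<dots> = ennreal (1 / (1 - b)) * epow (emeasure N (space N)) (1 - b)"
    unfolding pos(2) epow_ennreal[OF pos(1)] using b by (intro ennreal_mult) auto
  finally show ?thesis using add_left_mono by (auto simp: T_def)
qed

subsection \<open>The weighted Hardy inequality\<close>

text \<open>\<open>muckenhoupt\<close> pairs a closed exterior with an open ball, exactly as
  \<open>D1\<close> does. \<open>fin\<close> makes the measure with density \<open>om * f^q\<close>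
  finite, so it can serve as one factor in Tonelli's theorem.\<close>

locale weighted_hardy =
  fixes M :: "'a measure" and \<rho> :: "'a \<Rightarrow> real" and w om f :: "'a \<Rightarrow> ennreal" and q D :: real
  assumes meas [measurable]: "\<rho> \<in> borel_measurable M" "w \<in> borel_measurable M"
      "om \<in> borel_measurable M" "f \<in> borel_measurable M"
    and q: "1 < q" and D: "0 \<le> D"
    and muckenhoupt: "\<And>x. x \<in> space M \<Longrightarrow>
      epow (\<integral>\<^sup>+y. w y * indicator {y. \<rho> x \<le> \<rho> y} y \<partial>M) (1 / q)
      * epow (\<integral>\<^sup>+y. epow (om y) (1 - q / (q - 1)) * indicator {y. \<rho> y < \<rho> x} y \<partial>M) (1 - 1 / q) \<le> ennreal D"
    and fin: "(\<integral>\<^sup>+y. om y * epow (f y) q \<partial>M) < \<infinity>"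
begin

definition \<sigma> :: "'a \<Rightarrow> ennreal" where "\<sigma> y = epow (om y) (1 - q / (q - 1))"
definition g :: "'a \<Rightarrow> ennreal" where "g y = om y * epow (f y) q"
definition tail :: "'a \<Rightarrow> ennreal" where "tail x = (\<integral>\<^sup>+y. w y * indicator {y. \<rho> x \<le> \<rho> y} y \<partial>M)"
definition head :: "'a \<Rightarrow> ennreal" where "head x = (\<integral>\<^sup>+y. \<sigma> y * indicator {y. \<rho> y < \<rho> x} y \<partial>M)"
text \<open>Contains the sphere through \<open>x\<close>. It is thus a tail with respect to
  \<open>- \<rho>\<close>, to which the layer-cake estimate applies, and it is non-zero almost
  everywhere for the dual weight, so its negative powers are harmless.\<close>

definition head_closed :: "'a \<Rightarrow> ennreal" where "head_closed x = (\<integral>\<^sup>+y. \<sigma> y * indicator {y. \<rho> y \<le> \<rho> x} y \<partial>M)"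
text \<open>The first Hoelder factor raised to the power q; the power of \<open>head_closed\<close>
  is the auxiliary weight in Muckenhoupt's argument.\<close>

definition H :: "'a \<Rightarrow> ennreal" where
  "H x = (\<integral>\<^sup>+y. g y * epow (head_closed y) (1 - 1 / q) * indicator {y. \<rho> y < \<rho> x} y \<partial>M)"

section \<open>Measurability, finiteness and non-vanishing of the masses involved\<close>

lemma tail_head_le: "x \<in> space M \<Longrightarrow> epow (tail x) (1 / q) * epow (head x) (1 - 1 / q) \<le> ennreal D"
  using muckenhoupt by (simp add: tail_def head_def \<sigma>_def)

lemma q_facts: "0 < q" "0 < 1 / q" "0 < 1 - 1 / q" "1 - 1 / q < 1" "1 / (1 - 1 / q) = q / (q - 1)"
    "0 < q / (q - 1)" "1 - q / (q - 1) < 0"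
  using q by (auto simp: field_simps)

lemma [measurable]: "\<sigma> \<in> borel_measurable M" "g \<in> borel_measurable M"
  unfolding \<sigma>_def[abs_def] g_def[abs_def] by measurable

lemma [measurable]: "tail \<in> borel_measurable M"
  by (rule borel_measurable_mono_comp[where \<rho> = "\<lambda>x. - \<rho> x"
        and f = "\<lambda>r. \<integral>\<^sup>+y. w y * indicator {y. - r \<le> \<rho> y} y \<partial>M"])
     (auto simp: tail_def intro!: nn_integral_mono split: split_indicator)

lemma [measurable]: "head_closed \<in> borel_measurable M"
  by (rule borel_measurable_mono_comp[where \<rho> = \<rho>
        and f = "\<lambda>r. \<integral>\<^sup>+y. \<sigma> y * indicator {y. \<rho> y \<le> r} y \<partial>M"])
     (auto simp: head_closed_def intro!: nn_integral_mono split: split_indicator)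

lemma [measurable]: "H \<in> borel_measurable M"
  by (rule borel_measurable_mono_comp[where \<rho> = \<rho>
        and f = "\<lambda>r. \<integral>\<^sup>+y. g y * epow (head_closed y) (1 - 1 / q) * indicator {y. \<rho> y < r} y \<partial>M"])
     (auto simp: H_def intro!: nn_integral_mono split: split_indicator)

lemma emeasure_density_w: "emeasure (density M w) {y \<in> space M. \<rho> x \<le> \<rho> y} = tail x"
  unfolding tail_def by (subst emeasure_density) (auto intro!: nn_integral_cong split: split_indicator)

lemma emeasure_density_dual: "emeasure (density M \<sigma>) {y \<in> space M. \<rho> y \<le> \<rho> x} = head_closed x"
  unfolding head_closed_def by (subst emeasure_density) (auto intro!: nn_integral_cong split: split_indicator)

text \<open>The set where \<open>tail\<close> vanishes is exhausted by tails of mass 0. Such points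
  must be discarded because there the Muckenhoupt condition says nothing about
  \<open>head\<close>.\<close>

lemma AE_tail_nonzero: "AE x in M. w x \<noteq> 0 \<longrightarrow> tail x \<noteq> 0"
proof -
  have "emeasure (density M w) {x \<in> space M. tail x \<le> 0} \<le> 0"
    by (rule emeasure_le_of_tails[where \<rho> = \<rho>]) (auto simp: emeasure_density_w)
  then have "AE x in density M w. \<not> tail x \<le> 0"
    by (intro AE_I[where N = "{x \<in> space M. tail x \<le> 0}"]) auto
  then show ?thesis by (auto simp: AE_density elim: eventually_mono)
qed

lemma AE_head_closed_nonzero: "AE y in M. \<sigma> y \<noteq> 0 \<longrightarrow> head_closed y \<noteq> 0"
proof -
  have "emeasure (density M \<sigma>) {x \<in> space M. head_closed x \<le> 0} \<le> 0"
    by (rule emeasure_le_of_tails[where \<rho> = "\<lambda>x. - \<rho> x"]) (auto simp: emeasure_density_dual)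
  then have "AE x in density M \<sigma>. \<not> head_closed x \<le> 0"
    by (intro AE_I[where N = "{x \<in> space M. head_closed x \<le> 0}"]) auto
  then show ?thesis by (auto simp: AE_density elim: eventually_mono)
qed

lemma AE_g_finite: "AE y in M. g y \<noteq> \<infinity>"
  using fin by (intro nn_integral_noteq_infinite) (auto simp: g_def)

text \<open>The layer-cake estimate for \<open>- \<rho>\<close> with exponent
  \<open>b = 1 / q\<close>, so that 1 / (1 - b) is the conjugate exponent of q.\<close>

lemma nn_integral_dual_head_le:
  "(\<integral>\<^sup>+y. \<sigma> y * epow (head_closed y) (- (1 / q)) * indicator {y. \<rho> y < \<rho> x} y \<partial>M)
    \<le> ennreal (q / (q - 1)) * epow (head x) (1 - 1 / q)"
proof -
  \<comment> \<open>Restricting to the open ball makes the total mass \<open>head x\<close> and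
    leaves \<open>head_closed y\<close> unchanged for every \<open>y\<close> inside.\<close>
  define N where "N = density M (\<lambda>y. \<sigma> y * indicator {y. \<rho> y < \<rho> x} y)"
  have tot: "emeasure N (space N) = head x"
    unfolding N_def head_def by (simp add: emeasure_density cong: nn_integral_cong)
  have head_closed: "emeasure N {y' \<in> space N. - \<rho> y \<le> - \<rho> y'} = head_closed y" if "\<rho> y < \<rho> x" for y
    using that unfolding N_def head_closed_def
    by (subst emeasure_density) (auto intro!: nn_integral_cong split: split_indicator)
  have "(\<integral>\<^sup>+y. \<sigma> y * epow (head_closed y) (- (1 / q)) * indicator {y. \<rho> y < \<rho> x} y \<partial>M) = (\<integral>\<^sup>+y. epow (head_closed y) (- (1 / q)) \<partial>N)"
    unfolding N_def by (subst nn_integral_density) (auto intro!: nn_integral_cong simp: mult_ac)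
  also have "\<dots> = (\<integral>\<^sup>+y. epow (emeasure N {y' \<in> space N. - \<rho> y \<le> - \<rho> y'}) (- (1 / q)) \<partial>N)"
  proof (rule nn_integral_cong_AE)
    have "AE y in N. \<rho> y < \<rho> x"
      unfolding N_def by (subst AE_density) (auto split: split_indicator)
    then show "AE y in N. epow (head_closed y) (- (1 / q)) = epow (emeasure N {y' \<in> space N. - \<rho> y \<le> - \<rho> y'}) (- (1 / q))"
      by eventually_elim (simp only: head_closed)
  qed
  also have "\<dots> \<le> ennreal (1 / (1 - 1 / q)) * epow (emeasure N (space N)) (1 - 1 / q)"
    using q by (intro nn_integral_tail_powr_le) (auto simp: N_def)
  finally show ?thesis unfolding tot q_facts .
qed

text \<open>The exponents of \<open>om\<close> and of \<open>head_closed\<close> in the two factors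
  add up to 0, which leaves \<open>f\<close>. A finite dual weight forces
  \<open>om y \<noteq> 0\<close>, and then a finite \<open>g y\<close> forces \<open>om y\<close>
  and \<open>f y\<close> to be finite.\<close>

lemma f_eq_product:
  assumes "f y \<noteq> 0" "g y \<noteq> \<infinity>" "\<sigma> y \<noteq> \<infinity>" "\<sigma> y \<noteq> 0 \<longrightarrow> head_closed y \<noteq> 0" "head_closed y \<noteq> \<infinity>"
  shows "f y = epow (g y * epow (head_closed y) (1 - 1 / q)) (1 / q) * epow (\<sigma> y * epow (head_closed y) (- (1 / q))) (1 - 1 / q)"
proof -
  have "om y \<noteq> 0" using assms(3) q_facts by (auto simp: \<sigma>_def)
  moreover have "f y \<noteq> \<infinity>" "om y \<noteq> \<infinity>"
    using assms(1,2) \<open>om y \<noteq> 0\<close> q_facts epow_eq_0_iff[of "f y" q] by (auto simp: g_def ennreal_mult_eq_top_iff)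
  ultimately obtain c o' where o: "o' > 0" "om y = ennreal o'" and c: "c > 0" "f y = ennreal c"
    using assms(1) by (metis ennreal_zero_pos_top_cases)
  have "\<sigma> y \<noteq> 0" using o by (simp add: \<sigma>_def epow_ennreal)
  then obtain h where h: "h > 0" "head_closed y = ennreal h"
    using assms(4,5) by (metis ennreal_zero_pos_top_cases)
  have "(o' * c powr q * h powr (1 - 1/q)) powr (1/q) * (o' powr (1 - q/(q-1)) * h powr (-(1/q))) powr (1 - 1/q)
      = (o' powr (1/q) * o' powr ((1 - q/(q-1)) * (1 - 1/q))) * (h powr ((1 - 1/q)*(1/q)) * h powr (-(1/q) * (1 - 1/q))) * c"
    using o c h q by (simp add: powr_mult powr_powr mult_ac)
  also have "\<dots> = o' powr (1/q + (1 - q/(q-1)) * (1 - 1/q)) * h powr ((1 - 1/q)*(1/q) + -(1/q) * (1 - 1/q)) * c"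
    by (simp only: powr_add)
  also have "1/q + (1 - q/(q-1)) * (1 - 1/q) = 0" using q by (simp add: field_simps)
  also have "(1 - 1/q)*(1/q) + -(1/q) * (1 - 1/q) = 0" by simp
  finally show ?thesis using o c h
    by (simp add: g_def \<sigma>_def epow_ennreal flip: ennreal_mult del: ennreal_mult' ennreal_mult'')
qed

text \<open>Finiteness of \<open>head x\<close> makes the factorisation of \<open>f\<close>
  available almost everywhere in the ball. The second Hoelder factor is then evaluated by
  \<open>nn_integral_dual_head_le\<close>.\<close>

lemma hoelder_step:
  assumes "head x \<noteq> \<infinity>"
  shows "epow (\<integral>\<^sup>+y. f y * indicator {y. \<rho> y < \<rho> x} y \<partial>M) q
    \<le> H x * epow (ennreal (q / (q - 1)) * epow (head x) (1 - 1 / q)) (q - 1)"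
proof -
  let ?i = "\<lambda>y. indicator {y. \<rho> y < \<rho> x} y :: ennreal"
  let ?F = "\<lambda>y. epow (g y * epow (head_closed y) (1 - 1 / q)) (1 / q) * ?i y"
  let ?G = "\<lambda>y. epow (\<sigma> y * epow (head_closed y) (- (1 / q))) (1 - 1 / q) * ?i y"
  have "AE y in M. \<sigma> y * ?i y \<noteq> \<infinity>"
    using assms by (intro nn_integral_noteq_infinite) (auto simp: head_def)
  then have "AE y in M. f y * ?i y \<le> ?F y * ?G y"
    using AE_g_finite AE_head_closed_nonzero
  proof eventually_elim
    fix y assume A: "\<sigma> y * ?i y \<noteq> \<infinity>" "g y \<noteq> \<infinity>" "\<sigma> y \<noteq> 0 \<longrightarrow> head_closed y \<noteq> 0"
    show "f y * ?i y \<le> ?F y * ?G y"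
    proof (cases "\<rho> y < \<rho> x \<and> f y \<noteq> 0")
      case True
      have "head_closed y \<le> head x" unfolding head_closed_def head_def
        using True by (intro nn_integral_mono) (auto split: split_indicator)
      then have "head_closed y \<noteq> \<infinity>" using assms by (auto simp: top_unique)
      then show ?thesis using True A f_eq_product[of y] by simp
    qed auto
  qed
  then have "(\<integral>\<^sup>+y. f y * ?i y \<partial>M) \<le> (\<integral>\<^sup>+y. ?F y * ?G y \<partial>M)"
    by (rule nn_integral_mono_AE)
  also have "\<dots> \<le> epow (\<integral>\<^sup>+y. epow (?F y) q \<partial>M) (1 / q) * epow (\<integral>\<^sup>+y. epow (?G y) (q / (q - 1)) \<partial>M) (1 - 1 / q)"
    by (rule hoelder_nn_integral) (use q in auto)
  also have "(\<integral>\<^sup>+y. epow (?F y) q \<partial>M) = H x"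
    unfolding H_def using q
    by (intro nn_integral_cong) (auto simp: epow_mult epow_epow split: split_indicator)
  also have "(\<integral>\<^sup>+y. epow (?G y) (q / (q - 1)) \<partial>M) = (\<integral>\<^sup>+y. \<sigma> y * epow (head_closed y) (- (1 / q)) * ?i y \<partial>M)"
  proof -
    have "(1 - 1 / q) * (q / (q - 1)) = 1" using q by (simp add: field_simps)
    then show ?thesis using q
      by (intro nn_integral_cong) (auto simp: epow_epow split: split_indicator)
  qed
  also have "epow (H x) (1 / q) * epow \<dots> (1 - 1 / q)
      \<le> epow (H x) (1 / q) * epow (ennreal (q / (q - 1)) * epow (head x) (1 - 1 / q)) (1 - 1 / q)"
    using q_facts by (intro mult_left_mono epow_mono nn_integral_dual_head_le) auto
  finally have "epow (\<integral>\<^sup>+y. f y * ?i y \<partial>M) q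
     \<le> epow (epow (H x) (1 / q) * epow (ennreal (q / (q - 1)) * epow (head x) (1 - 1 / q)) (1 - 1 / q)) q"
    using q by (intro epow_mono) auto
  also have "\<dots> = H x * epow (ennreal (q / (q - 1)) * epow (head x) (1 - 1 / q)) ((1 - 1 / q) * q)"
    using q by (subst epow_mult) (auto simp only: epow_epow, auto)
  also have "(1 - 1 / q) * q = q - 1" using q by (simp add: field_simps)
  finally show ?thesis .
qed

text \<open>The Muckenhoupt condition trades head for tail: head^(1-1/q) is at most D * tail^(-1/q),
  and raising this to the power q - 1 produces tail^(-(1-1/q)).\<close>

lemma pointwise_step:
  assumes x: "x \<in> space M" and tail_w: "w x \<noteq> 0 \<longrightarrow> tail x \<noteq> 0"
  shows "w x * epow (\<integral>\<^sup>+y. f y * indicator {y. \<rho> y < \<rho> x} y \<partial>M) q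
    \<le> ennreal ((q / (q - 1) * D) powr (q - 1)) * (w x * epow (tail x) (- (1 - 1 / q)) * H x)"
proof (cases "w x = 0")
  case False
  with tail_w have tail0: "tail x \<noteq> 0" by simp
  show ?thesis
  proof (cases "tail x = \<infinity>")
    case True
    \<comment> \<open>An infinite tail forces the head to vanish; then
      \<open>om = \<infinity>\<close> almost everywhere in the ball, and finiteness of
      \<open>g\<close> leaves only \<open>f = 0\<close> there.\<close>
    have "head x = 0"
      using tail_head_le[OF x] True q_facts epow_eq_0_iff[of "head x" "1 - 1/q"]
      by (cases "epow (head x) (1 - 1 / q) = 0") (auto simp: ennreal_top_mult top_unique)
    then have "AE y in M. \<sigma> y * indicator {y. \<rho> y < \<rho> x} y = 0"
      by (simp add: head_def nn_integral_0_iff_AE)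
    then have "AE y in M. f y * indicator {y. \<rho> y < \<rho> x} y = 0"
      using AE_g_finite
    proof eventually_elim
      fix y assume A: "\<sigma> y * indicator {y. \<rho> y < \<rho> x} y = 0" "g y \<noteq> \<infinity>"
      show "f y * indicator {y. \<rho> y < \<rho> x} y = 0"
      proof (cases "\<rho> y < \<rho> x")
        case True
        then have "om y = \<infinity>" using A(1) q_facts by (simp add: \<sigma>_def epow_eq_0_iff)
        then have "epow (f y) q = 0" using A(2) by (auto simp: g_def ennreal_top_mult split: if_splits)
        then show ?thesis using q by (simp add: epow_eq_0_iff)
      qed simp
    qed
    then have "(\<integral>\<^sup>+y. f y * indicator {y. \<rho> y < \<rho> x} y \<partial>M) = 0"
      by (subst nn_integral_0_iff_AE) auto
    then show ?thesis using q by simp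
  next
    case False
    then obtain t where t: "t > 0" "tail x = ennreal t"
      using tail0 by (metis ennreal_zero_pos_top_cases)
    have head: "head x \<noteq> \<infinity>"
      using tail_head_le[OF x] t q_facts by (auto simp: epow_ennreal ennreal_mult_top top_unique)
    have "epow (head x) (1 - 1 / q) = epow (tail x) (- (1 / q)) * (epow (tail x) (1 / q) * epow (head x) (1 - 1 / q))"
      using epow_add[of "tail x" "- (1/q)" "1/q"] tail0 False by (simp flip: mult.assoc)
    also have "\<dots> \<le> epow (tail x) (- (1 / q)) * ennreal D"
      by (intro mult_left_mono tail_head_le x) auto
    finally have "epow (ennreal (q / (q - 1)) * epow (head x) (1 - 1 / q)) (q - 1)
        \<le> epow (ennreal (q / (q - 1)) * (epow (tail x) (- (1 / q)) * ennreal D)) (q - 1)"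
      using q by (intro epow_mono mult_left_mono) auto
    also have "ennreal (q / (q - 1)) * (epow (tail x) (- (1 / q)) * ennreal D)
        = ennreal (q / (q - 1) * D) * epow (tail x) (- (1 / q))"
      using q D by (simp add: ennreal_mult mult_ac del: times_divide_eq_left times_divide_eq_right)
    also have "epow \<dots> (q - 1) = ennreal ((q / (q - 1) * D) powr (q - 1)) * epow (tail x) (- (1 / q) * (q - 1))"
      using q D by (subst epow_mult) (auto simp only: epow_epow, auto simp: epow_ennreal_nonneg)
    also have "- (1 / q) * (q - 1) = - (1 - 1 / q)" using q by (simp add: field_simps)
    finally have "w x * (H x * epow (ennreal (q / (q - 1)) * epow (head x) (1 - 1 / q)) (q - 1))
       \<le> w x * (H x * (ennreal ((q / (q - 1) * D) powr (q - 1)) * epow (tail x) (- (1 - 1 / q))))"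
      by (intro mult_left_mono) auto
    with mult_left_mono[OF hoelder_step[OF head], of "w x"] show ?thesis
      by (simp add: mult_ac del: times_divide_eq_left times_divide_eq_right)
  qed
qed simp

text \<open>The condition with closed ball and open exterior. Each \<open>x\<close> with
  \<open>\<rho> y < \<rho> x\<close> satisfies \<open>head_closed y \<le> head x\<close>, which
  bounds \<open>tail x\<close> uniformly; the open exterior is exhausted by such tails.\<close>

lemma head_closed_tail_le:
  assumes y: "y \<in> space M"
  shows "epow (head_closed y) (1 - 1 / q) * epow (emeasure (density M w) {x \<in> space M. \<rho> y < \<rho> x}) (1 / q) \<le> ennreal D"
proof (cases "head_closed y = 0")
  case False
  have tail_le: "epow (tail x) (1 / q) * epow (head_closed y) (1 - 1 / q) \<le> ennreal D" if "x \<in> space M" "\<rho> y < \<rho> x" for x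
  proof -
    have "head_closed y \<le> head x" unfolding head_closed_def head_def
      using that by (intro nn_integral_mono) (auto split: split_indicator)
    then have "epow (tail x) (1 / q) * epow (head_closed y) (1 - 1 / q) \<le> epow (tail x) (1 / q) * epow (head x) (1 - 1 / q)"
      using q_facts by (intro mult_left_mono epow_mono) auto
    also have "\<dots> \<le> ennreal D" by (rule tail_head_le) fact
    finally show ?thesis .
  qed
  \<comment> \<open>The largest value of \<open>tail x\<close> compatible with the condition once
    \<open>head x\<close> is replaced by \<open>head_closed y\<close>.\<close>
  define c where "c = (if head_closed y = \<infinity> then 0 else epow (ennreal D * epow (head_closed y) (- (1 - 1 / q))) q)"
  have "emeasure (density M w) {x \<in> space M. \<rho> y < \<rho> x} \<le> c"
  proof (rule emeasure_le_of_tails[where \<rho> = \<rho>])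
    fix x assume "x \<in> {x \<in> space M. \<rho> y < \<rho> x}"
    then have tail_le_x: "epow (tail x) (1 / q) * epow (head_closed y) (1 - 1 / q) \<le> ennreal D" using tail_le by auto
    have "tail x \<le> c"
    proof (cases "head_closed y = \<infinity>")
      case True
      have "epow (tail x) (1 / q) = 0"
        using tail_le_x True q_facts by (cases "epow (tail x) (1 / q) = 0") (auto simp: ennreal_mult_top top_unique)
      then show ?thesis using q by (simp add: epow_eq_0_iff)
    next
      case PF: False
      have "epow (tail x) (1 / q) = (epow (tail x) (1 / q) * epow (head_closed y) (1 - 1 / q)) * epow (head_closed y) (- (1 - 1 / q))"
        using epow_add[of "head_closed y" "1 - 1/q" "- (1 - 1/q)"] False PF by (simp add: mult.assoc)
      also have "\<dots> \<le> ennreal D * epow (head_closed y) (- (1 - 1 / q))"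
        by (intro mult_right_mono tail_le_x) auto
      finally have "epow (epow (tail x) (1 / q)) q \<le> c"
        using q PF by (auto simp: c_def intro!: epow_mono)
      then show ?thesis using q by (simp add: epow_epow)
    qed
    then show "emeasure (density M w) {y \<in> space (density M w). \<rho> x \<le> \<rho> y} \<le> c"
      by (simp add: emeasure_density_w)
  qed auto
  then have "epow (head_closed y) (1 - 1 / q) * epow (emeasure (density M w) {x \<in> space M. \<rho> y < \<rho> x}) (1 / q)
     \<le> epow (head_closed y) (1 - 1 / q) * epow c (1 / q)"
    using q_facts by (intro mult_left_mono epow_mono) auto
  also have "\<dots> \<le> ennreal D"
  proof (cases "head_closed y = \<infinity>")
    case PF: False
    have "epow (head_closed y) (1 - 1 / q) * epow c (1 / q)
        = ennreal D * (epow (head_closed y) (1 - 1 / q) * epow (head_closed y) (- (1 - 1 / q)))"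
      using q PF by (simp add: c_def epow_epow mult_ac)
    also have "epow (head_closed y) (1 - 1 / q) * epow (head_closed y) (- (1 - 1 / q)) = 1"
      using epow_add[of "head_closed y" "1 - 1/q" "- (1 - 1/q)"] False PF by simp
    finally show ?thesis by simp
  qed (use q in \<open>auto simp: c_def\<close>)
  finally show ?thesis .
qed (use q_facts in auto)

text \<open>A cofinal sequence of points with finite tails covers
  \<open>{tail \<noteq> \<infinity>}\<close> by countably many sets of finite mass; the complement
  is null by the choice of density.\<close>

lemma sigma_finite_density_tail_finite:
  "sigma_finite_measure (density M (\<lambda>x. w x * indicator {x. tail x \<noteq> \<infinity>} x))" (is "sigma_finite_measure ?N")
proof -
  let ?E = "{x \<in> space M. tail x \<noteq> \<infinity>}"
  have null: "emeasure ?N (space M - ?E) = 0"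
    by (subst emeasure_density) (auto simp: nn_integral_0_iff_AE split: split_indicator)
  show ?thesis
  proof (cases "?E = {}")
    case True
    then have "space M - ?E = space M" by blast
    then have "emeasure ?N (space M) = 0" using null by metis
    then show ?thesis
      by (intro sigma_finite_measure.intro exI[of _ "{space M}"]) auto
  next
    case False
    then obtain xs where xs: "range xs \<subseteq> ?E" "decseq (\<lambda>n. \<rho> (xs n))"
        "?E \<subseteq> (\<Union>n. {y. \<rho> (xs n) \<le> \<rho> y})"
      by (rule exists_cofinal_sequence)
    let ?B = "\<lambda>n. {y \<in> space M. \<rho> (xs n) \<le> \<rho> y}"
    have "emeasure ?N (?B n) \<noteq> \<infinity>" for n
    proof -
      have "emeasure ?N (?B n) \<le> tail (xs n)" unfolding tail_def[of "xs n"]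
        by (subst emeasure_density) (auto intro!: nn_integral_mono split: split_indicator)
      moreover have "tail (xs n) \<noteq> \<infinity>" using subsetD[OF xs(1), of "xs n"] by auto
      ultimately show ?thesis by (auto simp: top_unique)
    qed
    then show ?thesis using null xs(3)
      by (intro sigma_finite_measure.intro exI[of _ "insert (space M - ?E) (range ?B)"]) auto
  qed
qed

text \<open>The layer-cake estimate for \<open>\<rho>\<close> with exponent
  \<open>b = 1 - 1 / q\<close>, hence the factor 1 / (1 - b) = q.\<close>

lemma nn_integral_tail_greater_le:
  assumes y: "y \<in> space M"
  shows "(\<integral>\<^sup>+x. epow (tail x) (- (1 - 1 / q)) * indicator {x. \<rho> y < \<rho> x} x
      \<partial>density M (\<lambda>x. w x * indicator {x. tail x \<noteq> \<infinity>} x))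
    \<le> ennreal q * epow (emeasure (density M w) {x \<in> space M. \<rho> y < \<rho> x}) (1 / q)"
proof -
  define N where "N = density M (\<lambda>x. w x * indicator {x. tail x \<noteq> \<infinity>} x * indicator {x. \<rho> y < \<rho> x} x)"
  have tot: "emeasure N (space N) \<le> emeasure (density M w) {x \<in> space M. \<rho> y < \<rho> x}"
    unfolding N_def
    by (subst (1 2) emeasure_density) (auto intro!: nn_integral_mono split: split_indicator)
  have tail_mono: "tail x' \<le> tail x" if "\<rho> x \<le> \<rho> x'" for x x'
    using that unfolding tail_def by (intro nn_integral_mono) (auto split: split_indicator)
  \<comment> \<open>Neither restriction changes the tail: it lies beyond the sphere through
    \<open>y\<close>, and all points in it have tails that are finite as well.\<close>
  have tail: "emeasure N {x' \<in> space N. \<rho> x \<le> \<rho> x'} = tail x" if "\<rho> y < \<rho> x" "tail x \<noteq> \<infinity>" for x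
  proof -
    have "tail x' \<noteq> \<infinity>" if "\<rho> x \<le> \<rho> x'" for x' using tail_mono[OF that] \<open>tail x \<noteq> \<infinity>\<close> by (auto simp: top_unique)
    then show ?thesis using that(1) unfolding N_def tail_def[of x]
      by (subst emeasure_density) (auto intro!: nn_integral_cong split: split_indicator)
  qed
  have "(\<integral>\<^sup>+x. epow (tail x) (- (1 - 1 / q)) * indicator {x. \<rho> y < \<rho> x} x
      \<partial>density M (\<lambda>x. w x * indicator {x. tail x \<noteq> \<infinity>} x)) = (\<integral>\<^sup>+x. epow (tail x) (- (1 - 1 / q)) \<partial>N)"
    unfolding N_def by (subst (1 2) nn_integral_density) (auto intro!: nn_integral_cong simp: mult_ac)
  also have "\<dots> = (\<integral>\<^sup>+x. epow (emeasure N {x' \<in> space N. \<rho> x \<le> \<rho> x'}) (- (1 - 1 / q)) \<partial>N)"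
  proof (rule nn_integral_cong_AE)
    have "AE x in N. \<rho> y < \<rho> x \<and> tail x \<noteq> \<infinity>"
      unfolding N_def by (subst AE_density) (auto split: split_indicator)
    then show "AE x in N. epow (tail x) (- (1 - 1 / q)) = epow (emeasure N {x' \<in> space N. \<rho> x \<le> \<rho> x'}) (- (1 - 1 / q))"
      by eventually_elim (metis tail)
  qed
  also have "\<dots> \<le> ennreal (1 / (1 - (1 - 1 / q))) * epow (emeasure N (space N)) (1 - (1 - 1 / q))"
    using q_facts by (intro nn_integral_tail_powr_le) (auto simp: N_def)
  also have "\<dots> \<le> ennreal q * epow (emeasure (density M w) {x \<in> space M. \<rho> y < \<rho> x}) (1 / q)"
    using q_facts tot by (auto intro!: mult_left_mono epow_mono)
  finally show ?thesis .
qed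

text \<open>
  \<open>M\<close> need not be sigma-finite, so Tonelli is applied to the measures with densities \<open>g\<close> and
  \<open>w\<close> restricted to \<open>{tail \<noteq> \<infinity>}\<close>; nothing is lost, as \<open>epow \<infinity> (- (1 - 1 / q)) = 0\<close>.
\<close>

lemma fubini_step:
  "(\<integral>\<^sup>+x. w x * epow (tail x) (- (1 - 1 / q)) * H x \<partial>M) \<le> ennreal (q * D) * (\<integral>\<^sup>+y. g y \<partial>M)"
proof -
  define N1 where "N1 = density M (\<lambda>x. w x * indicator {x. tail x \<noteq> \<infinity>} x)"
  define N2 where "N2 = density M g"
  have [measurable_cong]: "sets N1 = sets M" "sets N2 = sets M" by (auto simp: N1_def N2_def)
  interpret N1: sigma_finite_measure N1 unfolding N1_def by (rule sigma_finite_density_tail_finite)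
  interpret N2: finite_measure N2
    by (rule finite_measureI) (use fin in \<open>auto simp: N2_def emeasure_density g_def cong: nn_integral_cong\<close>)
  interpret P: pair_sigma_finite N2 N1 by unfold_locales
  have "(\<integral>\<^sup>+x. w x * epow (tail x) (- (1 - 1 / q)) * H x \<partial>M) = (\<integral>\<^sup>+x. epow (tail x) (- (1 - 1 / q)) * H x \<partial>N1)"
    unfolding N1_def using q
    by (subst nn_integral_density) (auto intro!: nn_integral_cong simp: mult_ac split: split_indicator)
  also have "\<dots> = (\<integral>\<^sup>+x. (\<integral>\<^sup>+y. epow (tail x) (- (1 - 1 / q)) * (epow (head_closed y) (1 - 1 / q) * indicator {y. \<rho> y < \<rho> x} y) \<partial>N2) \<partial>N1)"
    unfolding H_def N2_def
    by (intro nn_integral_cong, subst nn_integral_density)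
       (auto simp: nn_integral_cmult[symmetric] mult_ac N1_def intro!: nn_integral_cong)
  also have "\<dots> = (\<integral>\<^sup>+y. (\<integral>\<^sup>+x. epow (tail x) (- (1 - 1 / q)) * (epow (head_closed y) (1 - 1 / q) * indicator {y. \<rho> y < \<rho> x} y) \<partial>N1) \<partial>N2)"
    by (rule P.Fubini') measurable
  also have "\<dots> = (\<integral>\<^sup>+y. epow (head_closed y) (1 - 1 / q) * (\<integral>\<^sup>+x. epow (tail x) (- (1 - 1 / q)) * indicator {x. \<rho> y < \<rho> x} x \<partial>N1) \<partial>N2)"
    by (intro nn_integral_cong, subst nn_integral_cmult[symmetric])
       (auto intro!: nn_integral_cong simp: mult_ac split: split_indicator)
  \<comment> \<open>The weight carried by \<open>H\<close> is exactly what the condition absorbs, so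
    the inner integral is bounded uniformly in \<open>y\<close>.\<close>
  also have "\<dots> \<le> (\<integral>\<^sup>+y. ennreal (q * D) \<partial>N2)"
  proof (rule nn_integral_mono)
    fix y assume "y \<in> space N2"
    then have y: "y \<in> space M" by (simp add: N2_def)
    have "epow (head_closed y) (1 - 1 / q) * (\<integral>\<^sup>+x. epow (tail x) (- (1 - 1 / q)) * indicator {x. \<rho> y < \<rho> x} x \<partial>N1)
        \<le> epow (head_closed y) (1 - 1 / q) * (ennreal q * epow (emeasure (density M w) {x \<in> space M. \<rho> y < \<rho> x}) (1 / q))"
      unfolding N1_def by (intro mult_left_mono nn_integral_tail_greater_le y) auto
    also have "\<dots> = ennreal q * (epow (head_closed y) (1 - 1 / q) * epow (emeasure (density M w) {x \<in> space M. \<rho> y < \<rho> x}) (1 / q))"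
      by (simp add: mult_ac)
    also have "\<dots> \<le> ennreal q * ennreal D" by (intro mult_left_mono head_closed_tail_le y) auto
    also have "\<dots> = ennreal (q * D)" using q D by (simp add: ennreal_mult)
    finally show "epow (head_closed y) (1 - 1 / q) * (\<integral>\<^sup>+x. epow (tail x) (- (1 - 1 / q)) * indicator {x. \<rho> y < \<rho> x} x \<partial>N1)
      \<le> ennreal (q * D)" .
  qed
  also have "\<dots> = ennreal (q * D) * (\<integral>\<^sup>+y. g y \<partial>M)"
    by (simp add: N2_def emeasure_density cong: nn_integral_cong)
  finally show ?thesis .
qed

text \<open>Hoelder's inequality with the head estimate contributes (q' D)^(q-1), where q' = q / (q
  - 1), and Tonelli's theorem contributes q D.\<close>

theorem hardy:
  "(\<integral>\<^sup>+x. w x * epow (\<integral>\<^sup>+y. f y * indicator {y. \<rho> y < \<rho> x} y \<partial>M) q \<partial>M)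
    \<le> ennreal (q * (q / (q - 1)) powr (q - 1) * D powr q) * (\<integral>\<^sup>+y. om y * epow (f y) q \<partial>M)"
proof -
  have "(\<integral>\<^sup>+x. w x * epow (\<integral>\<^sup>+y. f y * indicator {y. \<rho> y < \<rho> x} y \<partial>M) q \<partial>M)
    \<le> (\<integral>\<^sup>+x. ennreal ((q / (q - 1) * D) powr (q - 1)) * (w x * epow (tail x) (- (1 - 1 / q)) * H x) \<partial>M)"
    by (rule nn_integral_mono_AE)
       (use AE_tail_nonzero AE_space in eventually_elim, rule pointwise_step)
  also have "\<dots> = ennreal ((q / (q - 1) * D) powr (q - 1)) * (\<integral>\<^sup>+x. w x * epow (tail x) (- (1 - 1 / q)) * H x \<partial>M)"
    by (rule nn_integral_cmult) measurable
  also have "\<dots> \<le> ennreal ((q / (q - 1) * D) powr (q - 1)) * (ennreal (q * D) * (\<integral>\<^sup>+y. g y \<partial>M))"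
    by (intro mult_left_mono fubini_step) auto
  also have "\<dots> = ennreal ((q / (q - 1) * D) powr (q - 1) * (q * D)) * (\<integral>\<^sup>+y. g y \<partial>M)"
    using q D by (simp add: ennreal_mult mult.assoc)
  also have "(q / (q - 1) * D) powr (q - 1) * (q * D) = q * (q / (q - 1)) powr (q - 1) * D powr q"
  proof -
    have "D powr (q - 1) * D = D powr q"
      using D by (cases "D = 0") (auto simp: powr_diff)
    moreover have "(q / (q - 1) * D) powr (q - 1) = (q / (q - 1)) powr (q - 1) * D powr (q - 1)"
      by (rule powr_mult)
    ultimately show ?thesis by (simp add: mult_ac)
  qed
  finally show ?thesis by (simp add: g_def)
qed

end

subsection \<open>The fractional Hardy inequality\<close>

text \<open>
  Used in place of Minkowski: for \<open>\<integral> x^q \<le> \<kappa>^q \<integral> (x + y)^q\<close> the first term is at most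
  \<open>\<kappa> \<integral> (x + y)^q\<close> and can be absorbed.
\<close>

lemma epow_add_le_convex:
  assumes q: "1 < q" and \<kappa>: "0 < \<kappa>" "\<kappa> < 1"
  shows "epow (x + y) q \<le> ennreal (\<kappa> powr (1 - q)) * epow x q + ennreal ((1 - \<kappa>) powr (1 - q)) * epow y q"
proof -
  have ge1: "c powr (1 - q) \<ge> 1" if "0 < c" "c < 1" for c
    using powr_mono2'[of "1 - q" c 1] that q by simp
  have *: "e \<le> ennreal (c powr (1 - q)) * e" if "0 < c" "c < 1" for c e
    using mult_right_mono[OF ennreal_leI[OF ge1[OF that]], of e] by simp
  consider "x = 0" | "y = 0" | "x = \<infinity> \<or> y = \<infinity>" | r t where "r > 0" "t > 0" "x = ennreal r" "y = ennreal t"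
    by (cases x rule: ennreal_zero_pos_top_cases; cases y rule: ennreal_zero_pos_top_cases) auto
  then show ?thesis
  proof cases
    case 3
    then show ?thesis using q \<kappa> by (auto simp: ennreal_mult_top)
  next
    case (4 r t)
    \<comment> \<open>Convexity of the q-th power for the weights \<open>\<kappa>\<close> and
      \<open>1 - \<kappa>\<close> at the rescaled points.\<close>
    have "(\<kappa> * (r / \<kappa>) + (1 - \<kappa>) * (t / (1 - \<kappa>))) powr q
        \<le> \<kappa> * (r / \<kappa>) powr q + (1 - \<kappa>) * (t / (1 - \<kappa>)) powr q"
      using convex_onD[OF powr_convex[of q], of "1 - \<kappa>" "r / \<kappa>" "t / (1 - \<kappa>)"] 4 q \<kappa> by simp
    also have "\<kappa> * (r / \<kappa>) + (1 - \<kappa>) * (t / (1 - \<kappa>)) = r + t" using \<kappa> by simp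
    also have "\<kappa> * (r / \<kappa>) powr q = \<kappa> powr (1 - q) * r powr q"
      using \<kappa> 4 by (simp add: powr_divide powr_diff)
    also have "(1 - \<kappa>) * (t / (1 - \<kappa>)) powr q = (1 - \<kappa>) powr (1 - q) * t powr q"
      using \<kappa> 4 by (simp add: powr_divide powr_diff)
    finally show ?thesis using 4
      by (simp add: epow_ennreal flip: ennreal_mult ennreal_plus del: ennreal_mult' ennreal_mult'')
  qed (use q *[OF \<kappa>] *[of "1 - \<kappa>"] \<kappa> in auto)
qed

section \<open>The concrete weights attached to \<open>v\<close> and \<open>z\<close>\<close>

locale fractional_hardy =
  fixes M :: "'a::metric_space measure" and a :: 'a and s p q :: real and v z :: "'a \<Rightarrow> real"
  assumes borel [measurable_cong]: "sets M = sets borel"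
    and s_pos: "s > 0" and p_gt: "1 < p" and pq: "p < q"
    and v_meas [measurable]: "v \<in> borel_measurable M" and v_nonneg: "\<And>x. v x \<ge> 0"
    and z_meas [measurable]: "z \<in> borel_measurable M" and z_nonneg: "\<And>x. z x \<ge> 0"
begin

abbreviation \<rho> :: "'a \<Rightarrow> real" where "\<rho> \<equiv> dist a"
abbreviation V :: "'a \<Rightarrow> ennreal" where "V \<equiv> Vfun M a v"
abbreviation A :: "'a \<Rightarrow> ennreal" where "A \<equiv> Afun M a p q v z"
definition b :: "'a \<Rightarrow> ennreal" where "b x = emeasure M (ball a (\<rho> x))"
text \<open>The integrand is \<open>v * z^(-1/p)\<close> raised to the conjugate exponent of p, that
  is, the second factor when Hoelder's inequality is weighted by \<open>z\<close>.\<close>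

definition W0 :: "'a \<Rightarrow> ennreal" where
  "W0 x = (\<integral>\<^sup>+ y \<in> ball a (\<rho> x). epow (epow (ennreal (v y)) p / ennreal (z y)) (1 / (p - 1)) \<partial>M)"
definition w :: "'a \<Rightarrow> ennreal" where "w y = A y / (epow (ennreal (\<rho> y)) (s * q) * epow (V y) q)"
definition om :: "'a \<Rightarrow> ennreal" where
  "om y = A y * epow (ennreal (v y)) (- q) / epow (ennreal (\<rho> y)) (s * q)"

lemma space_M [simp]: "space M = UNIV"
  using sets_eq_imp_space_eq[OF borel] by simp

lemma q_gt: "1 < q" using p_gt pq by simp

lemma dist_measurable [measurable]: "(\<lambda>x. dist c x) \<in> borel_measurable M"
proof -
  have "(\<lambda>x. dist c x) \<in> borel_measurable borel"
    by (intro borel_measurable_continuous_onI continuous_intros)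
  then show ?thesis using measurable_cong_sets[OF borel refl] by auto
qed

lemma dist_measurable' [measurable]: "(\<lambda>x. dist x c) \<in> borel_measurable M"
  using dist_measurable[of c] by (simp add: dist_commute)

lemma ball_measurable [measurable]: "ball c r \<in> sets M"
  unfolding borel by simp

lemma V_measurable [measurable]: "V \<in> borel_measurable M"
  by (rule borel_measurable_mono_comp[where \<rho> = \<rho> and f = "\<lambda>r. \<integral>\<^sup>+ y \<in> ball a r. ennreal (v y) \<partial>M"])
     (auto simp: Vfun_def intro!: nn_integral_mono split: split_indicator)

lemma b_measurable [measurable]: "b \<in> borel_measurable M"
  by (rule borel_measurable_mono_comp[where \<rho> = \<rho> and f = "\<lambda>r. emeasure M (ball a r)"])
     (auto simp: b_def intro!: emeasure_mono)

lemma W0_measurable [measurable]: "W0 \<in> borel_measurable M"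
  by (rule borel_measurable_mono_comp[where \<rho> = \<rho>
        and f = "\<lambda>r. \<integral>\<^sup>+ y \<in> ball a r. epow (epow (ennreal (v y)) p / ennreal (z y)) (1 / (p - 1)) \<partial>M"])
     (auto simp: W0_def intro!: nn_integral_mono split: split_indicator)

lemma A_eq: "A x = epow (b x) (- (q / p)) * epow (W0 x) (- (q / (p / (p - 1)))) * epow (V x) q * ennreal (v x)"
  by (simp add: Afun_def b_def W0_def)

lemma A_measurable [measurable]: "A \<in> borel_measurable M"
  unfolding A_eq[abs_def] by measurable

lemma w_measurable [measurable]: "w \<in> borel_measurable M"
  unfolding w_def[abs_def] by measurable

lemma om_measurable [measurable]: "om \<in> borel_measurable M"
  unfolding om_def[abs_def] by measurable

lemma indicator_ball: "indicator (ball a (\<rho> x)) y = (indicator {y. \<rho> y < \<rho> x} y :: ennreal)"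
  by (auto split: split_indicator)

lemma indicator_compl_ball: "indicator (UNIV - ball a (\<rho> x)) y = (indicator {y. \<rho> x \<le> \<rho> y} y :: ennreal)"
  by (auto split: split_indicator)

lemma D1_eq: "D1 M a s p q v z = (SUP x \<in> UNIV - {a}.
    epow (\<integral>\<^sup>+y. w y * indicator {y. \<rho> x \<le> \<rho> y} y \<partial>M) (1 / q)
    * epow (\<integral>\<^sup>+y. epow (om y) (1 - q / (q - 1)) * indicator {y. \<rho> y < \<rho> x} y \<partial>M) (1 - 1 / q))"
proof -
  have "1 / (q / (q - 1)) = 1 - 1 / q" using q_gt by (simp add: field_simps)
  then show ?thesis
    unfolding D1_def w_def[symmetric] om_def[symmetric] indicator_ball indicator_compl_ball by simp
qed

text \<open>The supremum in \<open>D1\<close> omits the centre; there the ball is empty, so the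
  second factor vanishes.\<close>

lemma muckenhoupt:
  assumes "D1 M a s p q v z < \<infinity>"
  shows "epow (\<integral>\<^sup>+y. w y * indicator {y. \<rho> x \<le> \<rho> y} y \<partial>M) (1 / q)
    * epow (\<integral>\<^sup>+y. epow (om y) (1 - q / (q - 1)) * indicator {y. \<rho> y < \<rho> x} y \<partial>M) (1 - 1 / q)
    \<le> ennreal (enn2real (D1 M a s p q v z))"
proof (cases "x = a")
  case True
  have "1 - 1 / q > 0" using q_gt by simp
  then have "epow (\<integral>\<^sup>+y. epow (om y) (1 - q / (q - 1)) * indicator {y. \<rho> y < \<rho> x} y \<partial>M) (1 - 1 / q) = 0"
    using True by (subst epow_eq_0_iff) (simp add: not_less)
  then show ?thesis by simp
next
  case False
  then have "epow (\<integral>\<^sup>+y. w y * indicator {y. \<rho> x \<le> \<rho> y} y \<partial>M) (1 / q)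
    * epow (\<integral>\<^sup>+y. epow (om y) (1 - q / (q - 1)) * indicator {y. \<rho> y < \<rho> x} y \<partial>M) (1 - 1 / q)
    \<le> D1 M a s p q v z"
    unfolding D1_eq by (intro SUP_upper2[of x]) auto
  also have "\<dots> = ennreal (enn2real (D1 M a s p q v z))" using assms by simp
  finally show ?thesis .
qed

context
  fixes u :: "'a \<Rightarrow> real"
  assumes u_meas [measurable]: "u \<in> borel_measurable M"
begin

definition G :: "'a \<Rightarrow> ennreal" where "G = Gfun M a s p q v z u"
text \<open>The weighted mean of \<open>|u|\<close> over the ball, multiplied by \<open>V x\<close>;
  leaving out the division avoids a case split on \<open>V\<close>.\<close>

definition U :: "'a \<Rightarrow> ennreal" where
  "U x = (\<integral>\<^sup>+y. ennreal \<bar>u y\<bar> * ennreal (v y) * indicator {y. \<rho> y < \<rho> x} y \<partial>M)"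

lemma G_measurable [measurable]: "G \<in> borel_measurable M"
  unfolding G_def Gfun_def[abs_def] by measurable

lemma U_measurable [measurable]: "U \<in> borel_measurable M"
  by (rule borel_measurable_mono_comp[where \<rho> = \<rho>
        and f = "\<lambda>r. \<integral>\<^sup>+y. ennreal \<bar>u y\<bar> * ennreal (v y) * indicator {y. \<rho> y < r} y \<partial>M"])
     (auto simp: U_def intro!: nn_integral_mono split: split_indicator)

lemma G_powr: "epow (G x) q = A x * epow (ennreal \<bar>u x\<bar>) q / epow (ennreal (\<rho> x)) (s * q)"
  using q_gt epow_minus[of "ennreal (\<rho> x)" "s * q"]
  by (simp add: G_def Gfun_def epow_mult epow_epow divide_ennreal_def)

text \<open>Identifies the right side of Hardy's inequality for \<open>f = |u| v\<close> as the
  integral of \<open>G^q\<close>. Where \<open>v\<close> vanishes so does \<open>A\<close>, hence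
  both sides.\<close>

lemma om_f_powr: "om x * epow (ennreal \<bar>u x\<bar> * ennreal (v x)) q = epow (G x) q"
proof (cases "v x = 0")
  case True
  then show ?thesis by (simp add: G_powr om_def A_eq)
next
  case False
  then have "v x > 0" using v_nonneg[of x] by simp
  then have "epow (ennreal (v x)) (- q) * epow (ennreal (v x)) q = 1"
    using epow_add[of "ennreal (v x)" "- q" q] by simp
  then show ?thesis using q_gt
    by (simp add: G_powr om_def epow_mult divide_ennreal_def mult_ac)
       (simp add: mult.assoc[symmetric])
qed

lemma hardy_U:
  assumes D1: "D1 M a s p q v z < \<infinity>" and fin: "(\<integral>\<^sup>+x. epow (G x) q \<partial>M) < \<infinity>"
  shows "(\<integral>\<^sup>+x. w x * epow (U x) q \<partial>M)
    \<le> ennreal (q * (q / (q - 1)) powr (q - 1) * enn2real (D1 M a s p q v z) powr q) * (\<integral>\<^sup>+x. epow (G x) q \<partial>M)"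
proof -
  interpret H: weighted_hardy M \<rho> w om "\<lambda>y. ennreal \<bar>u y\<bar> * ennreal (v y)" q "enn2real (D1 M a s p q v z)"
    by unfold_locales (use q_gt muckenhoupt[OF D1] fin in \<open>auto simp: om_f_powr\<close>)
  show ?thesis using H.hardy by (simp add: om_f_powr U_def)
qed

section \<open>Comparison of the oscillation over a ball with the double integral\<close>

definition kern :: "'a \<Rightarrow> 'a \<Rightarrow> ennreal" where
  "kern y x = ennreal (\<bar>u x - u y\<bar> powr p * z x)
     / (epow (ennreal (dist x y)) (s * p) * emeasure M (ball a (dist x y / 2)))"

lemma Ifun_eq: "Ifun M a s p q v z u = (\<integral>\<^sup>+y. epow (\<integral>\<^sup>+x. kern y x \<partial>M) (q / p) * ennreal (v y) \<partial>M)"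
  by (simp add: Ifun_def kern_def)

lemma kern_measurable [measurable]: "kern y \<in> borel_measurable M"
proof -
  have [measurable]: "(\<lambda>x. emeasure M (ball a (dist x y / 2))) \<in> borel_measurable M"
    by (rule borel_measurable_mono_comp[where \<rho> = "\<lambda>x. dist x y" and f = "\<lambda>r. emeasure M (ball a (r / 2))"])
       (auto intro!: emeasure_mono)
  show ?thesis unfolding kern_def[abs_def] by measurable
qed

definition E :: "'a \<Rightarrow> ennreal" where
  "E x = (\<integral>\<^sup>+y. ennreal (\<bar>u y - u x\<bar> powr p * z y) * indicator {y. \<rho> y < \<rho> x} y \<partial>M)"

text \<open>For \<open>y\<close> in the ball, d(x,y) < 2 |x|_a, so the ball about \<open>a\<close>
  of radius d(x,y)/2 lies in the one of radius |x|_a. The denominator of the kernel is therefore at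
  most 2^(sp) |x|_a^(sp) \<open>b x\<close>.\<close>

lemma E_le_kern:
  assumes b: "b x \<noteq> \<infinity>"
  shows "E x * inverse (b x * ennreal (\<rho> x powr (s * p))) \<le> ennreal (2 powr (s * p)) * (\<integral>\<^sup>+y. kern x y \<partial>M)"
proof -
  let ?R = "ennreal (\<rho> x powr (s * p))" and ?c = "ennreal (2 powr (s * p))"
  have sp: "s * p > 0" using s_pos p_gt by simp
  have "E x * inverse (b x * ?R)
      = (\<integral>\<^sup>+y. ennreal (\<bar>u y - u x\<bar> powr p * z y) * indicator {y. \<rho> y < \<rho> x} y * inverse (b x * ?R) \<partial>M)"
    unfolding E_def by (rule nn_integral_multc[symmetric]) measurable
  also have "\<dots> \<le> (\<integral>\<^sup>+y. ?c * kern x y \<partial>M)"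
  proof (rule nn_integral_mono)
    fix y
    show "ennreal (\<bar>u y - u x\<bar> powr p * z y) * indicator {y. \<rho> y < \<rho> x} y * inverse (b x * ?R) \<le> ?c * kern x y"
    proof (cases "\<rho> y < \<rho> x")
      case True
      let ?d = "dist y x" and ?m = "emeasure M (ball a (dist y x / 2))"
      have d: "?d < 2 * \<rho> x" "?d > 0"
        using dist_triangle[of y x a] True by (auto simp: dist_commute)
      have c1: "?c * inverse ?c = 1"
        by (simp add: inverse_ennreal flip: ennreal_mult)
      have "?d powr (s * p) \<le> (2 * \<rho> x) powr (s * p)" using d sp by (intro powr_mono2) auto
      then have "epow (ennreal ?d) (s * p) \<le> ?c * ?R"
        using d by (simp add: epow_ennreal powr_mult flip: ennreal_mult)
      moreover have "?m \<le> b x" unfolding b_def using d by (intro emeasure_mono) auto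
      ultimately have "epow (ennreal ?d) (s * p) * ?m \<le> ?c * ?R * b x" by (intro mult_mono) auto
      then have "inverse (?c * (b x * ?R)) \<le> inverse (epow (ennreal ?d) (s * p) * ?m)"
        by (intro inverse_antimono_ennreal) (simp add: mult_ac)
      also have "inverse (?c * (b x * ?R)) = inverse ?c * inverse (b x * ?R)"
        by (rule ennreal_inverse_mult) (use b in \<open>auto simp: ennreal_mult_less_top less_top\<close>)
      finally have "?c * (inverse ?c * inverse (b x * ?R)) \<le> ?c * inverse (epow (ennreal ?d) (s * p) * ?m)"
        by (rule mult_left_mono) simp
      then have "inverse (b x * ?R) \<le> ?c * inverse (epow (ennreal ?d) (s * p) * ?m)"
        by (simp only: mult.assoc[symmetric] c1) simp
      then have "ennreal (\<bar>u y - u x\<bar> powr p * z y) * inverse (b x * ?R)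
          \<le> ennreal (\<bar>u y - u x\<bar> powr p * z y) * (?c * inverse (epow (ennreal ?d) (s * p) * ?m))"
        by (rule mult_left_mono) simp
      then show ?thesis using True by (simp add: kern_def divide_ennreal_def mult_ac)
    qed simp
  qed
  also have "\<dots> = ?c * (\<integral>\<^sup>+y. kern x y \<partial>M)" by (rule nn_integral_cmult) simp
  finally show ?thesis .
qed

text \<open>Hoelder's inequality for the factors \<open>|u y - u x| * z^(1/p)\<close> and
  \<open>v * z^(-1/p)\<close>.\<close>

lemma oscillation_le:
  assumes W0: "W0 x \<noteq> \<infinity>"
  shows "(\<integral>\<^sup>+y. ennreal \<bar>u y - u x\<bar> * ennreal (v y) * indicator {y. \<rho> y < \<rho> x} y \<partial>M)
    \<le> epow (E x) (1 / p) * epow (W0 x) (1 - 1 / p)"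
proof -
  let ?i = "\<lambda>y. indicator {y. \<rho> y < \<rho> x} y :: ennreal"
  let ?Q = "\<lambda>y. epow (ennreal (v y)) p / ennreal (z y)"
  let ?F = "\<lambda>y. epow (ennreal (\<bar>u y - u x\<bar> powr p * z y)) (1 / p) * ?i y"
  let ?H = "\<lambda>y. epow (?Q y) (1 / p) * ?i y"
  have "AE y in M. epow (?Q y) (1 / (p - 1)) * ?i y \<noteq> \<infinity>"
    using W0 by (intro nn_integral_noteq_infinite) (auto simp: W0_def indicator_ball)
  then have "AE y in M. ennreal \<bar>u y - u x\<bar> * ennreal (v y) * ?i y \<le> ?F y * ?H y"
  proof eventually_elim
    fix y assume fin: "epow (?Q y) (1 / (p - 1)) * ?i y \<noteq> \<infinity>"
    show "ennreal \<bar>u y - u x\<bar> * ennreal (v y) * ?i y \<le> ?F y * ?H y"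
    proof (cases "\<rho> y < \<rho> x \<and> v y \<noteq> 0 \<and> u y \<noteq> u x")
      case True
      then have v: "v y > 0" using v_nonneg[of y] by simp
      \<comment> \<open>Finiteness of \<open>W0 x\<close> excludes, up to a null set, points of the
        ball with \<open>z = 0\<close> and \<open>v > 0\<close>, where the factorisation would
        break.\<close>
      have z: "z y > 0"
      proof (rule ccontr)
        assume "\<not> z y > 0"
        then have "?Q y = \<infinity>" using z_nonneg[of y] v
          by (simp add: epow_ennreal divide_ennreal_def ennreal_mult_top)
        then show False using fin True p_gt by simp
      qed
      have "(\<bar>u y - u x\<bar> powr p * z y) powr (1 / p) * (v y powr p / z y) powr (1 / p) = \<bar>u y - u x\<bar> * v y"
        using v z p_gt True by (simp add: powr_mult powr_divide powr_powr)
      then show ?thesis using v z True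
        by (simp add: epow_ennreal divide_ennreal flip: ennreal_mult)
    qed (auto split: split_indicator)
  qed
  then have "(\<integral>\<^sup>+y. ennreal \<bar>u y - u x\<bar> * ennreal (v y) * ?i y \<partial>M) \<le> (\<integral>\<^sup>+y. ?F y * ?H y \<partial>M)"
    by (rule nn_integral_mono_AE)
  also have "\<dots> \<le> epow (\<integral>\<^sup>+y. epow (?F y) p \<partial>M) (1 / p) * epow (\<integral>\<^sup>+y. epow (?H y) (p / (p - 1)) \<partial>M) (1 - 1 / p)"
    by (rule hoelder_nn_integral) (use p_gt in auto)
  also have "(\<integral>\<^sup>+y. epow (?F y) p \<partial>M) = E x"
    unfolding E_def using p_gt
    by (intro nn_integral_cong) (auto simp: epow_epow split: split_indicator)
  also have "(\<integral>\<^sup>+y. epow (?H y) (p / (p - 1)) \<partial>M) = W0 x"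
    unfolding W0_def indicator_ball using p_gt
    by (intro nn_integral_cong) (auto simp: epow_epow divide_less_0_iff split: split_indicator)
  finally show ?thesis .
qed

text \<open>The triangle inequality for \<open>u\<close>, integrated against \<open>v\<close> over
  the ball. Subtraction is truncated at 0; finiteness of \<open>V x\<close> permits moving
  \<open>U x\<close> across.\<close>

lemma remainder_le:
  assumes "V x \<noteq> \<infinity>"
  shows "ennreal \<bar>u x\<bar> * V x - U x
    \<le> (\<integral>\<^sup>+y. ennreal \<bar>u y - u x\<bar> * ennreal (v y) * indicator {y. \<rho> y < \<rho> x} y \<partial>M)" (is "_ \<le> ?O")
proof -
  let ?i = "\<lambda>y. indicator {y. \<rho> y < \<rho> x} y :: ennreal"
  have "ennreal \<bar>u x\<bar> * V x = (\<integral>\<^sup>+y. ennreal \<bar>u x\<bar> * (ennreal (v y) * ?i y) \<partial>M)"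
    unfolding Vfun_def indicator_ball by (rule nn_integral_cmult[symmetric]) measurable
  also have "\<dots> \<le> (\<integral>\<^sup>+y. ennreal \<bar>u y\<bar> * ennreal (v y) * ?i y + ennreal \<bar>u y - u x\<bar> * ennreal (v y) * ?i y \<partial>M)"
  proof (rule nn_integral_mono)
    fix y
    have "ennreal \<bar>u x\<bar> \<le> ennreal \<bar>u y\<bar> + ennreal \<bar>u y - u x\<bar>"
      by (subst ennreal_plus[symmetric]) (auto intro!: ennreal_leI simp del: ennreal_plus)
    then have "ennreal \<bar>u x\<bar> * (ennreal (v y) * ?i y) \<le> (ennreal \<bar>u y\<bar> + ennreal \<bar>u y - u x\<bar>) * (ennreal (v y) * ?i y)"
      by (rule mult_right_mono) simp
    then show "ennreal \<bar>u x\<bar> * (ennreal (v y) * ?i y)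
        \<le> ennreal \<bar>u y\<bar> * ennreal (v y) * ?i y + ennreal \<bar>u y - u x\<bar> * ennreal (v y) * ?i y"
      by (simp add: distrib_right mult.assoc)
  qed
  also have "\<dots> = U x + ?O"
    unfolding U_def by (rule nn_integral_add) measurable
  finally have "ennreal \<bar>u x\<bar> * V x \<le> U x + ?O" .
  moreover have "ennreal \<bar>u x\<bar> * V x \<noteq> top" using assms by (simp add: ennreal_mult_eq_top_iff)
  ultimately show ?thesis by (simp add: ennreal_minus_le_iff)
qed

text \<open>A non-zero product has no zero factor, and if it is also finite it has no infinite one;
  negative exponents turn this into two-sided information on \<open>b\<close> and \<open>W0\<close>.
  Finally \<open>V a = 0\<close> excludes the centre.\<close>

lemma A_nondegenerate:
  assumes "A x \<noteq> 0" "A x \<noteq> \<infinity>"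
  obtains \<beta> \<omega> \<nu> where "\<beta> > 0" "b x = ennreal \<beta>" "\<omega> > 0" "W0 x = ennreal \<omega>"
    "\<nu> > 0" "V x = ennreal \<nu>" "v x > 0" "\<rho> x > 0"
proof -
  have pos: "q / p > 0" "q / (p / (p - 1)) > 0" "q > 0" using p_gt pq by auto
  have nz: "epow (b x) (- (q / p)) \<noteq> 0" "epow (W0 x) (- (q / (p / (p - 1)))) \<noteq> 0" "epow (V x) q \<noteq> 0" "v x \<noteq> 0"
    using assms(1) unfolding A_eq by auto
  then have "b x \<noteq> \<infinity>" "W0 x \<noteq> \<infinity>" "V x \<noteq> 0"
    using pos unfolding epow_eq_0_iff by auto
  moreover have "epow (b x) (- (q / p)) \<noteq> top" "epow (W0 x) (- (q / (p / (p - 1)))) \<noteq> top" "epow (V x) q \<noteq> top"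
    using assms(2) nz v_nonneg[of x] unfolding A_eq by (auto simp: ennreal_mult_eq_top_iff)
  then have "b x \<noteq> 0" "W0 x \<noteq> 0" "V x \<noteq> \<infinity>"
    using pos unfolding epow_eq_top_iff by auto
  moreover have "x \<noteq> a" using \<open>V x \<noteq> 0\<close> by (auto simp: Vfun_def)
  ultimately show ?thesis using that nz(4) v_nonneg[of x]
    by (metis ennreal_zero_pos_top_cases order_le_less zero_less_dist_iff)
qed

text \<open>The reason for the form of \<open>A\<close>: its power of \<open>W0\<close> cancels the
  second Hoelder factor, \<open>V^q\<close> cancels the denominator of \<open>w\<close>, and the
  rest is the q/p-th power of the kernel bound, times \<open>v\<close>.\<close>

lemma w_W0_eq:
  assumes "\<beta> > 0" "b x = ennreal \<beta>" "\<omega> > 0" "W0 x = ennreal \<omega>"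
    "\<nu> > 0" "V x = ennreal \<nu>" "v x > 0" "\<rho> x > 0"
  shows "w x * epow (W0 x) ((1 - 1 / p) * q)
    = ennreal (v x) * epow (inverse (b x * ennreal (\<rho> x powr (s * p)))) (q / p)"
proof -
  let ?e = "q / (p / (p - 1))"
  have e: "(1 - 1 / p) * q = ?e" using p_gt by (simp add: field_simps)
  have "\<beta> powr (- (q / p)) * \<omega> powr (- ?e) * \<nu> powr q * v x / (\<rho> x powr (s * q) * \<nu> powr q) * \<omega> powr ?e
      = v x * (\<beta> powr (- (q / p)) / \<rho> x powr (s * q)) * (\<omega> powr (- ?e) * \<omega> powr ?e)"
    using assms by simp
  also have "\<omega> powr (- ?e) * \<omega> powr ?e = 1" using assms by (simp flip: powr_add)
  also have "\<beta> powr (- (q / p)) / \<rho> x powr (s * q) = inverse (\<beta> * \<rho> x powr (s * p)) powr (q / p)"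
  proof -
    have "s * p * (q / p) = s * q" using p_gt by simp
    then show ?thesis using assms
      by (simp add: powr_minus inverse_powr powr_mult powr_powr divide_inverse[of "inverse _"])
  qed
  finally have *: "\<beta> powr (- (q / p)) * \<omega> powr (- ?e) * \<nu> powr q * v x / (\<rho> x powr (s * q) * \<nu> powr q) * \<omega> powr ?e
      = v x * inverse (\<beta> * \<rho> x powr (s * p)) powr (q / p)" by simp
  show ?thesis
    using assms arg_cong[OF *, of ennreal] unfolding w_def A_eq e
    by (simp add: epow_ennreal inverse_ennreal divide_ennreal flip: ennreal_mult)
qed

lemma remainder_powr_le:
  assumes "A x \<noteq> 0" "A x \<noteq> \<infinity>"
  shows "w x * epow (ennreal \<bar>u x\<bar> * V x - U x) q
    \<le> ennreal (2 powr (s * q)) * (epow (\<integral>\<^sup>+y. kern x y \<partial>M) (q / p) * ennreal (v x))"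
proof -
  obtain \<beta> \<omega> \<nu> where nd: "\<beta> > 0" "b x = ennreal \<beta>" "\<omega> > 0" "W0 x = ennreal \<omega>"
    "\<nu> > 0" "V x = ennreal \<nu>" "v x > 0" "\<rho> x > 0"
    using A_nondegenerate[OF assms] by metis
  have qp: "q > 0" "q / p > 0" using p_gt pq by auto
  let ?c = "inverse (b x * ennreal (\<rho> x powr (s * p)))"
  have "ennreal \<bar>u x\<bar> * V x - U x \<le> epow (E x) (1 / p) * epow (W0 x) (1 - 1 / p)"
    using remainder_le[of x] oscillation_le[of x] nd by (auto intro: order_trans)
  then have "w x * epow (ennreal \<bar>u x\<bar> * V x - U x) q \<le> w x * epow (epow (E x) (1 / p) * epow (W0 x) (1 - 1 / p)) q"
    using qp by (intro mult_left_mono epow_mono) auto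
  also have "\<dots> = epow (E x) (q / p) * (w x * epow (W0 x) ((1 - 1 / p) * q))"
    using qp by (simp add: epow_mult epow_epow mult_ac del: times_divide_eq_right times_divide_eq_left) (simp add: mult_ac)
  also have "\<dots> = ennreal (v x) * epow (E x * ?c) (q / p)"
    unfolding w_W0_eq[OF nd] using qp by (simp add: epow_mult mult_ac)
  also have "\<dots> \<le> ennreal (v x) * epow (ennreal (2 powr (s * p)) * (\<integral>\<^sup>+y. kern x y \<partial>M)) (q / p)"
    using qp nd by (intro mult_left_mono epow_mono E_le_kern) auto
  also have "\<dots> = ennreal (2 powr (s * q)) * (epow (\<integral>\<^sup>+y. kern x y \<partial>M) (q / p) * ennreal (v x))"
  proof -
    have "epow (ennreal (2 powr (s * p))) (q / p) = ennreal (2 powr (s * q))"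
      using p_gt by (simp add: epow_ennreal powr_powr)
    then show ?thesis using qp by (simp add: epow_mult mult_ac)
  qed
  finally show ?thesis .
qed

text \<open>With X for the integral of \<open>G^q\<close> and I for the double integral, convexity
  and Hardy's inequality give X \<le> \<kappa> X + (1-\<kappa>)^(1-q) 2^(sq) I. As X is finite,
  \<kappa> X can be subtracted, and dividing by 1-\<kappa> gives the constant.\<close>

theorem fractional_hardy:
  assumes D1: "D1 M a s p q v z < \<infinity>" and fin: "(\<integral>\<^sup>+x. epow (G x) q \<partial>M) < \<infinity>"
    and \<kappa>: "0 < \<kappa>" "\<kappa> < 1"
    and K: "q * (q / (q - 1)) powr (q - 1) * enn2real (D1 M a s p q v z) powr q \<le> \<kappa> powr q"
  shows "(\<integral>\<^sup>+x. epow (G x) q \<partial>M)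
    \<le> ennreal ((1 - \<kappa>) powr (- q) * 2 powr (s * q)) * Ifun M a s p q v z u"
proof (cases "Ifun M a s p q v z u = \<infinity>")
  case True
  then show ?thesis using \<kappa> by (simp add: ennreal_mult_top)
next
  case False
  define R where "R = (\<lambda>x. w x * epow (ennreal \<bar>u x\<bar> * V x - U x) q)"
  have [measurable]: "R \<in> borel_measurable M" unfolding R_def by measurable
  let ?c = "ennreal (\<kappa> powr (1 - q))" and ?d = "ennreal ((1 - \<kappa>) powr (1 - q))"
  have G_fin: "AE x in M. epow (G x) q \<noteq> \<infinity>"
    using fin by (intro nn_integral_noteq_infinite) auto
  \<comment> \<open>Since |x|_a^(sq) is finite, \<open>A x = \<infinity>\<close> with
    \<open>u x \<noteq> 0\<close> would make \<open>G x\<close> infinite.\<close>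
  have G0: "A x = 0 \<or> u x = 0 \<or> A x \<noteq> \<infinity>" if "epow (G x) q \<noteq> \<infinity>" for x
  proof (rule ccontr)
    assume "\<not> ?thesis"
    then have "A x = \<infinity>" "u x \<noteq> 0" by auto
    moreover have "epow (ennreal (\<rho> x)) (s * q) \<noteq> \<infinity>"
      by (simp add: epow_eq_top_iff) (use mult_pos_pos[OF s_pos, of q] q_gt in linarith)
    ultimately have "epow (G x) q = \<infinity>" unfolding G_powr using q_gt
      by (simp add: divide_ennreal_def ennreal_top_mult epow_eq_0_iff)
    with that show False by simp
  qed
  have split: "epow (G x) q \<le> ?c * (w x * epow (U x) q) + ?d * R x" if Gx: "epow (G x) q \<noteq> \<infinity>" for x
  proof (cases "A x = 0 \<or> u x = 0")
    case True
    then have "epow (G x) q = 0" using q_gt by (auto simp: G_powr)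
    then show ?thesis by simp
  next
    case False
    then obtain \<beta> \<omega> \<nu> where nd: "\<nu> > 0" "V x = ennreal \<nu>" "v x > 0" "\<rho> x > 0"
      using G0[OF Gx] A_nondegenerate[of x] by metis
    let ?X = "epow (ennreal (\<rho> x)) (s * q)"
    have one: "epow (V x) q * inverse (epow (V x) q) = 1"
      using nd by (simp add: epow_ennreal inverse_ennreal flip: ennreal_mult)
    have inv: "inverse (?X * epow (V x) q) = inverse ?X * inverse (epow (V x) q)"
      using nd by (intro ennreal_inverse_mult) (auto simp: epow_ennreal)
    have "epow (G x) q = A x * epow (ennreal \<bar>u x\<bar>) q * inverse ?X * (epow (V x) q * inverse (epow (V x) q))"
      by (simp add: one G_powr divide_ennreal_def)
    also have "\<dots> = A x * (inverse ?X * inverse (epow (V x) q)) * (epow (ennreal \<bar>u x\<bar>) q * epow (V x) q)"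
      by (simp only: mult_ac)
    also have "\<dots> = w x * epow (ennreal \<bar>u x\<bar> * V x) q"
      using q_gt by (simp add: w_def divide_ennreal_def inv epow_mult)
    also have "\<dots> \<le> w x * epow (U x + (ennreal \<bar>u x\<bar> * V x - U x)) q"
    proof -
      \<comment> \<open>The right side is the maximum of the two terms, as the subtraction is
        truncated.\<close>
      have "ennreal \<bar>u x\<bar> * V x \<le> U x + (ennreal \<bar>u x\<bar> * V x - U x)"
        by (cases "U x \<le> ennreal \<bar>u x\<bar> * V x") (auto simp: add_diff_inverse_ennreal intro: add_increasing2)
      then show ?thesis using q_gt by (intro mult_left_mono epow_mono) auto
    qed
    also have "\<dots> \<le> w x * (?c * epow (U x) q + ?d * epow (ennreal \<bar>u x\<bar> * V x - U x) q)"
      by (intro mult_left_mono epow_add_le_convex q_gt \<kappa>) auto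
    also have "\<dots> = ?c * (w x * epow (U x) q) + ?d * R x" by (simp add: R_def distrib_left mult_ac)
    finally show ?thesis .
  qed
  have R_le: "R x \<le> ennreal (2 powr (s * q)) * (epow (\<integral>\<^sup>+y. kern x y \<partial>M) (q / p) * ennreal (v x))"
    if "epow (G x) q \<noteq> \<infinity>" for x
  proof (cases "A x = 0 \<or> u x = 0")
    case True
    then have "R x = 0" using q_gt by (auto simp: R_def w_def)
    then show ?thesis by simp
  next
    case False
    then show ?thesis using remainder_powr_le[of x] G0[OF that] by (simp add: R_def)
  qed
  have "(\<integral>\<^sup>+x. R x \<partial>M) \<le> ennreal (2 powr (s * q)) * Ifun M a s p q v z u"
  proof -
    \<comment> \<open>The constant is moved to \<open>R\<close>, whose measurability is known;
      measurability of the integrand of \<open>Ifun\<close> in its outer variable is not at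
      hand.\<close>
    have "(\<integral>\<^sup>+x. R x \<partial>M) * inverse (ennreal (2 powr (s * q))) = (\<integral>\<^sup>+x. R x * inverse (ennreal (2 powr (s * q))) \<partial>M)"
      by (rule nn_integral_multc[symmetric]) simp
    also have "\<dots> \<le> Ifun M a s p q v z u" unfolding Ifun_eq
    proof (rule nn_integral_mono_AE, use G_fin in eventually_elim)
      fix x assume "epow (G x) q \<noteq> \<infinity>"
      from mult_right_mono[OF R_le[OF this], of "inverse (ennreal (2 powr (s * q)))"]
      show "R x * inverse (ennreal (2 powr (s * q))) \<le> epow (\<integral>\<^sup>+y. kern x y \<partial>M) (q / p) * ennreal (v x)"
        by (simp add: mult_ac inverse_ennreal) (simp add: mult.assoc[symmetric] flip: ennreal_mult)
    qed
    finally have "(\<integral>\<^sup>+x. R x \<partial>M) * inverse (ennreal (2 powr (s * q))) * ennreal (2 powr (s * q))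
        \<le> Ifun M a s p q v z u * ennreal (2 powr (s * q))" by (rule mult_right_mono) simp
    then show ?thesis
      by (simp add: mult_ac inverse_ennreal) (simp add: mult.assoc[symmetric] flip: ennreal_mult)
  qed
  obtain \<gamma> where \<gamma>: "\<gamma> \<ge> 0" "(\<integral>\<^sup>+x. epow (G x) q \<partial>M) = ennreal \<gamma>"
    using fin by (cases "\<integral>\<^sup>+x. epow (G x) q \<partial>M") auto
  obtain \<iota> where \<iota>: "\<iota> \<ge> 0" "Ifun M a s p q v z u = ennreal \<iota>"
    using False by (cases "Ifun M a s p q v z u") auto
  have "ennreal \<gamma> \<le> (\<integral>\<^sup>+x. ?c * (w x * epow (U x) q) + ?d * R x \<partial>M)"
    unfolding \<gamma>(2)[symmetric] by (rule nn_integral_mono_AE, use G_fin in eventually_elim) (rule split)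
  also have "\<dots> = ?c * (\<integral>\<^sup>+x. w x * epow (U x) q \<partial>M) + ?d * (\<integral>\<^sup>+x. R x \<partial>M)"
    by (simp add: nn_integral_add nn_integral_cmult)
  also have "\<dots> \<le> ?c * (ennreal (\<kappa> powr q) * ennreal \<gamma>) + ?d * (ennreal (2 powr (s * q)) * ennreal \<iota>)"
  proof (intro add_mono mult_left_mono)
    show "(\<integral>\<^sup>+x. w x * epow (U x) q \<partial>M) \<le> ennreal (\<kappa> powr q) * ennreal \<gamma>"
      using hardy_U[OF D1 fin] mult_right_mono[OF ennreal_leI[OF K], of "ennreal \<gamma>"] unfolding \<gamma> by (auto intro: order_trans)
    show "(\<integral>\<^sup>+x. R x \<partial>M) \<le> ennreal (2 powr (s * q)) * ennreal \<iota>"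
      unfolding \<iota>(2)[symmetric] by fact
  qed auto
  also have "\<dots> = ennreal (\<kappa> powr (1 - q) * (\<kappa> powr q * \<gamma>) + (1 - \<kappa>) powr (1 - q) * (2 powr (s * q) * \<iota>))"
    using \<gamma>(1) \<iota>(1) by (simp add: ennreal_mult)
  finally have "\<gamma> \<le> \<kappa> powr (1 - q) * (\<kappa> powr q * \<gamma>) + (1 - \<kappa>) powr (1 - q) * (2 powr (s * q) * \<iota>)"
    using \<gamma>(1) \<iota>(1) by (subst (asm) ennreal_le_iff) auto
  also have "\<kappa> powr (1 - q) * (\<kappa> powr q * \<gamma>) = \<kappa> * \<gamma>"
    using \<kappa> by (simp add: powr_diff)
  finally have "(1 - \<kappa>) * \<gamma> \<le> (1 - \<kappa>) powr (1 - q) * (2 powr (s * q) * \<iota>)" by (simp add: algebra_simps)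
  also have "\<dots> = (1 - \<kappa>) * ((1 - \<kappa>) powr (- q) * 2 powr (s * q) * \<iota>)"
    using \<kappa> by (simp add: powr_diff powr_minus divide_inverse)
  finally have "\<gamma> \<le> (1 - \<kappa>) powr (- q) * 2 powr (s * q) * \<iota>" using \<kappa> by simp
  then show ?thesis unfolding \<gamma> \<iota>(2) using \<iota>(1)
    by (subst ennreal_mult[symmetric]) (auto intro: ennreal_leI)
qed

end

end

subsection \<open>The entropy estimate\<close>

text \<open>An integrable majorant bounds the positive part, so the difference is never \<infinity>
  - \<infinity>; an infinite negative part makes it minus infinity.\<close>

lemma enn2ereal_diff_le_integral:
  fixes h k :: "'a \<Rightarrow> real"
  assumes [measurable]: "h \<in> borel_measurable M" and k: "integrable M k" and le: "AE x in M. h x \<le> k x"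
  shows "enn2ereal (\<integral>\<^sup>+ x. ennreal (max 0 (h x)) \<partial>M) - enn2ereal (\<integral>\<^sup>+ x. ennreal (max 0 (- h x)) \<partial>M)
    \<le> ereal (\<integral>x. k x \<partial>M)"
proof -
  have P: "(\<integral>\<^sup>+ x. ennreal (max 0 (h x)) \<partial>M) < \<infinity>"
  proof -
    have "(\<integral>\<^sup>+ x. ennreal (max 0 (h x)) \<partial>M) \<le> (\<integral>\<^sup>+ x. ennreal (norm (k x)) \<partial>M)"
      by (rule nn_integral_mono_AE) (use le in \<open>eventually_elim, auto intro!: ennreal_leI\<close>)
    also have "\<dots> < \<infinity>" using k by (simp add: integrable_iff_bounded)
    finally show ?thesis .
  qed
  show ?thesis
  proof (cases "(\<integral>\<^sup>+ x. ennreal (max 0 (- h x)) \<partial>M) = \<infinity>")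
    case True
    then show ?thesis using P
      by (cases "\<integral>\<^sup>+ x. ennreal (max 0 (h x)) \<partial>M") (auto simp: enn2ereal_ennreal)
  next
    case False
    have ip: "integrable M (\<lambda>x. max 0 (h x))" "integrable M (\<lambda>x. max 0 (- h x))"
      using P False by (auto intro!: integrableI_nonneg simp: less_top)
    have ih: "integrable M h"
      by (rule Bochner_Integration.integrable_cong[THEN iffD1, OF refl _ Bochner_Integration.integrable_diff[OF ip]]) auto
    have "(\<integral>x. max 0 (h x) \<partial>M) - (\<integral>x. max 0 (- h x) \<partial>M) = (\<integral>x. max 0 (h x) - max 0 (- h x) \<partial>M)"
      using ip by simp
    also have "\<dots> = (\<integral>x. h x \<partial>M)" by (rule Bochner_Integration.integral_cong) auto
    also have "\<dots> \<le> (\<integral>x. k x \<partial>M)" by (rule integral_mono_AE[OF ih k le])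
    finally show ?thesis using ip
      by (simp add: nn_integral_eq_integral enn2ereal_ennreal)
  qed
qed

text \<open>Jensen's inequality in pointwise form: \<open>ln\<close> lies below its tangent at
  \<tau>, the mean of \<open>t / g\<close> under the density \<open>g\<close>. This yields an
  integrable majorant even if \<open>g * ln g\<close> is not integrable.\<close>

lemma entropy_int_le:
  fixes G :: "'a \<Rightarrow> ennreal" and p q :: real
  assumes [measurable]: "G \<in> borel_measurable M" and pq: "0 < p" "p < q"
    and P: "(\<integral>\<^sup>+x. epow (G x) p \<partial>M) = ennreal P" "0 < P"
    and Q: "(\<integral>\<^sup>+x. epow (G x) q \<partial>M) = ennreal Q" "0 < Q"
  shows "entropy_int M (\<lambda>x. enn2real (epow (G x) p) / P) \<le> ereal (q / (q - p) * ln (Q powr (p / q) / P))"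
proof -
  define g where "g = (\<lambda>x. enn2real (epow (G x) p) / P)"
  define t where "t = (\<lambda>x. enn2real (epow (G x) q) / P powr (q / p))"
  define \<tau> where "\<tau> = Q / P powr (q / p)"
  have [measurable]: "g \<in> borel_measurable M" "t \<in> borel_measurable M" unfolding g_def t_def by measurable
  have \<tau>: "\<tau> > 0" using P Q by (simp add: \<tau>_def)
  have fin: "AE x in M. G x \<noteq> \<infinity>"
  proof -
    have "AE x in M. epow (G x) p \<noteq> \<infinity>"
      by (rule nn_integral_noteq_infinite) (auto simp: P)
    then show ?thesis by eventually_elim (use pq in auto)
  qed
  have en: "integrable M (\<lambda>x. enn2real (epow (G x) e)) \<and> (\<integral>x. enn2real (epow (G x) e) \<partial>M) = R"
    if "0 < e" "(\<integral>\<^sup>+x. epow (G x) e \<partial>M) = ennreal R" "0 < R" for e R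
  proof -
    have "(\<integral>\<^sup>+x. ennreal (enn2real (epow (G x) e)) \<partial>M) = ennreal R"
      unfolding that(2)[symmetric]
    proof (rule nn_integral_cong_AE, use fin in eventually_elim)
      fix x assume "G x \<noteq> \<infinity>"
      then have "epow (G x) e \<noteq> \<infinity>" using that(1) by (simp add: epow_eq_top_iff)
      then show "ennreal (enn2real (epow (G x) e)) = epow (G x) e" by (simp add: less_top)
    qed
    then show ?thesis using that(3)
      by (auto intro!: integrableI_nonneg simp: integral_eq_nn_integral)
  qed
  have ig: "integrable M g" "(\<integral>x. g x \<partial>M) = 1"
    using en[OF _ P] pq P by (auto simp: g_def)
  have it: "integrable M t" "(\<integral>x. t x \<partial>M) = \<tau>"
    using en[OF _ Q] pq P by (auto simp: t_def \<tau>_def)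
  \<comment> \<open>Here g ln g = p/(q-p) g ln(t/g), because \<open>t\<close> is \<open>g\<close> to
    the power q/p; \<open>k\<close> replaces the logarithm by its tangent at \<tau>.\<close>
  define k where "k = (\<lambda>x. p / (q - p) * (t x / \<tau> - g x + ln \<tau> * g x))"
  have ik: "integrable M k" using ig it unfolding k_def by auto
  have "(\<integral>x. k x \<partial>M) = p / (q - p) * (\<tau> / \<tau> - 1 + ln \<tau> * 1)"
    unfolding k_def using ig it by simp
  also have "\<dots> = p / (q - p) * ln \<tau>" using \<tau> by simp
  also have "ln \<tau> = q / p * ln (Q powr (p / q) / P)"
    using P Q pq by (simp add: \<tau>_def ln_div ln_powr field_simps)
  finally have k_eq: "(\<integral>x. k x \<partial>M) = q / (q - p) * ln (Q powr (p / q) / P)"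
    using pq by simp
  have "AE x in M. (if g x = 0 then 0 else g x * ln (g x)) \<le> k x"
    using fin
  proof eventually_elim
    fix x assume G: "G x \<noteq> \<infinity>"
    show "(if g x = 0 then 0 else g x * ln (g x)) \<le> k x"
    proof (cases "G x = 0")
      case True
      then show ?thesis using pq by (simp add: g_def t_def k_def)
    next
      case False
      then obtain r where r: "r > 0" "G x = ennreal r" using G by (metis ennreal_zero_pos_top_cases)
      have gx: "g x = r powr p / P" and tx: "t x = r powr q / P powr (q / p)"
        using r by (auto simp: g_def t_def epow_ennreal)
      have pos: "g x > 0" "t x > 0" using r P by (auto simp: gx tx)
      have ln_g: "ln (g x) = p / (q - p) * ln (t x / g x)"
        using r P pq by (simp add: gx tx ln_div ln_powr ln_mult field_simps)
      have "ln (t x / g x / \<tau>) \<le> t x / g x / \<tau> - 1"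
        using pos \<tau> by (intro ln_le_minus_one) auto
      then have "ln (t x / g x) \<le> t x / g x / \<tau> - 1 + ln \<tau>"
        using pos \<tau> ln_div[of "t x / g x" \<tau>] by simp
      then have "p / (q - p) * g x * ln (t x / g x) \<le> p / (q - p) * g x * (t x / g x / \<tau> - 1 + ln \<tau>)"
        using pq pos by (intro mult_left_mono) auto
      also have "\<dots> = k x"
      proof -
        have "g x * (t x / g x / \<tau> - 1 + ln \<tau>) = t x / \<tau> - g x + ln \<tau> * g x"
          using pos by (simp add: algebra_simps)
        then show ?thesis by (simp only: k_def mult.assoc)
      qed
      finally show ?thesis using pos by (simp add: ln_g mult_ac)
    qed
  qed
  from enn2ereal_diff_le_integral[OF _ ik this] show ?thesis
    unfolding entropy_int_def Let_def k_eq g_def[symmetric] by simp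
qed

text \<open>For an infinite double integral the informal right side is infinite, whereas
  \<open>enn2real\<close> would turn it into 0; hence the premise
  \<open>Ifun M a s p q v z u < \<infinity>\<close>.\<close>

theorem theorem2p5:
  fixes M :: "'a::metric_space measure" and a :: 'a and s p q :: real
    and v z :: "'a \<Rightarrow> real"
  assumes borel: "sets M = sets borel"
    and polar: "polar_decomposition M a"
    and s_pos: "s > 0" and p_gt: "1 < p" and pq: "p < q"
    and v_meas: "v \<in> borel_measurable M" and v_nonneg: "\<And>x. v x \<ge> 0"
    and z_meas: "z \<in> borel_measurable M" and z_nonneg: "\<And>x. z x \<ge> 0"
    and D1_fin: "D1 M a s p q v z < \<infinity>"
    and D1_small: "(q / (q - 1)) powr (1 / (q / (q - 1))) * q powr (1 / q) * enn2real (D1 M a s p q v z) < 1"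
  shows "\<exists>C > 0. \<forall>u \<in> borel_measurable M.
           (\<integral>\<^sup>+ x. epow (Gfun M a s p q v z u x) p \<partial>M) < \<infinity>
         \<longrightarrow> (\<integral>\<^sup>+ x. epow (Gfun M a s p q v z u x) q \<partial>M) < \<infinity>
         \<longrightarrow> \<not> (AE x in M. Gfun M a s p q v z u x = 0)
         \<longrightarrow> Ifun M a s p q v z u < \<infinity>
         \<longrightarrow> entropy_int M (\<lambda>x. enn2real (epow (Gfun M a s p q v z u x) p)
                               / enn2real (\<integral>\<^sup>+ x. epow (Gfun M a s p q v z u x) p \<partial>M))
             \<le> ereal (q / (q - p) * ln (C * enn2real (epow (Ifun M a s p q v z u) (p / q))
                               / enn2real (\<integral>\<^sup>+ x. epow (Gfun M a s p q v z u x) p \<partial>M)))"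
proof -
  interpret F: fractional_hardy M a s p q v z
    using borel s_pos p_gt pq v_meas v_nonneg z_meas z_nonneg by unfold_locales
  have q: "1 < q" using p_gt pq by simp
  define D where "D = enn2real (D1 M a s p q v z)"
  define K where "K = (q / (q - 1)) powr (1 / (q / (q - 1))) * q powr (1 / q) * D"
  \<comment> \<open>\<open>K\<close> may be 0, but the convexity inequality needs a positive
    parameter.\<close>
  define \<kappa> where "\<kappa> = max K (1 / 2)"
  have D: "D \<ge> 0" and K0: "K \<ge> 0" and K1: "K < 1"
    using D1_small by (auto simp: D_def K_def)
  have \<kappa>: "0 < \<kappa>" "\<kappa> < 1" using K1 by (auto simp: \<kappa>_def)
  have "q * (q / (q - 1)) powr (q - 1) * D powr q = K powr q"
  proof -
    have "1 / (q / (q - 1)) * q = q - 1" using q by simp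
    then show ?thesis using q D unfolding K_def by (simp add: powr_mult powr_powr)
  qed
  also have "\<dots> \<le> \<kappa> powr q" using K0 q by (intro powr_mono2) (auto simp: \<kappa>_def)
  finally have K_le: "q * (q / (q - 1)) powr (q - 1) * enn2real (D1 M a s p q v z) powr q \<le> \<kappa> powr q"
    unfolding D_def .
  define c where "c = (1 - \<kappa>) powr (- q) * 2 powr (s * q)"
  have c: "c > 0" using \<kappa> by (simp add: c_def)
  show ?thesis
  proof (intro exI[of _ "c powr (p / q)"] conjI ballI impI)
    show "c powr (p / q) > 0" using c by simp
    fix u :: "'a \<Rightarrow> real"
    assume u [measurable]: "u \<in> borel_measurable M"
      and fin_p: "(\<integral>\<^sup>+ x. epow (Gfun M a s p q v z u x) p \<partial>M) < \<infinity>"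
      and fin_q: "(\<integral>\<^sup>+ x. epow (Gfun M a s p q v z u x) q \<partial>M) < \<infinity>"
      and nz: "\<not> (AE x in M. Gfun M a s p q v z u x = 0)"
      and I_fin: "Ifun M a s p q v z u < \<infinity>"
    let ?G = "Gfun M a s p q v z u"
    have G [measurable]: "?G \<in> borel_measurable M"
      using F.G_measurable[OF u] by (simp add: F.G_def[OF u])
    have pos: "(\<integral>\<^sup>+ x. epow (?G x) e \<partial>M) \<noteq> 0" if "e > 0" for e
      using nz that by (simp add: nn_integral_0_iff_AE epow_eq_0_iff)
    obtain P where P: "P > 0" "(\<integral>\<^sup>+ x. epow (?G x) p \<partial>M) = ennreal P"
      using pos[of p] fin_p p_gt by (cases "\<integral>\<^sup>+ x. epow (?G x) p \<partial>M" rule: ennreal_zero_pos_top_cases) auto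
    obtain Q where Q: "Q > 0" "(\<integral>\<^sup>+ x. epow (?G x) q \<partial>M) = ennreal Q"
      using pos[of q] fin_q q by (cases "\<integral>\<^sup>+ x. epow (?G x) q \<partial>M" rule: ennreal_zero_pos_top_cases) auto
    obtain \<iota> where \<iota>: "\<iota> \<ge> 0" "Ifun M a s p q v z u = ennreal \<iota>"
      using I_fin by (cases "Ifun M a s p q v z u") auto
    have "ennreal Q \<le> ennreal c * ennreal \<iota>"
      using F.fractional_hardy[OF u D1_fin _ \<kappa> K_le] fin_q Q \<iota> by (simp add: F.G_def[OF u] c_def)
    then have Q_le: "Q \<le> c * \<iota>" using c \<iota>(1) by (simp flip: ennreal_mult)
    \<comment> \<open>A vanishing double integral would force \<open>Q = 0\<close>, so the final
      logarithm has a positive argument.\<close>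
    then have \<iota>_pos: "\<iota> > 0" using Q c \<iota>(1) by (cases "\<iota> = 0") auto
    have "Q powr (p / q) \<le> (c * \<iota>) powr (p / q)" using Q Q_le p_gt q by (intro powr_mono2) auto
    also have "\<dots> = c powr (p / q) * \<iota> powr (p / q)" using c \<iota>(1) by (simp add: powr_mult)
    finally have "ln (Q powr (p / q) / P) \<le> ln (c powr (p / q) * \<iota> powr (p / q) / P)"
      using P Q by (intro ln_mono divide_right_mono divide_pos_pos) auto
    then have "q / (q - p) * ln (Q powr (p / q) / P) \<le> q / (q - p) * ln (c powr (p / q) * \<iota> powr (p / q) / P)"
      using q pq by (intro mult_left_mono) auto
    moreover have "entropy_int M (\<lambda>x. enn2real (epow (?G x) p) / P) \<le> ereal (q / (q - p) * ln (Q powr (p / q) / P))"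
      using p_gt pq P Q by (intro entropy_int_le G) auto
    ultimately show "entropy_int M (\<lambda>x. enn2real (epow (?G x) p) / enn2real (\<integral>\<^sup>+ x. epow (?G x) p \<partial>M))
        \<le> ereal (q / (q - p) * ln (c powr (p / q) * enn2real (epow (Ifun M a s p q v z u) (p / q))
            / enn2real (\<integral>\<^sup>+ x. epow (?G x) p \<partial>M)))"
      using P \<iota> \<iota>_pos by (simp add: epow_ennreal order_trans)
  qed
qed

end
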